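(* There exist absolute constants $c, C > 0$, with $c < 1$, such that the following holds for every convex symmetric body $K$ in $\mathbb{R}^n$ and every integer $1 \le k \le n$. (i) If there exists a section of $K$ of dimension $k$ whose diameter is bounded by $1$, then a random section of $K$ of dimension $\lfloor ck \rfloor$ has diameter at most $C^{n/k}$ with probability at least $1 - e^{-cn}$. (ii) If there exists a section of $K$ of dimension $n - \lfloor ck \rfloor$ whose diameter is bounded by $1$, then a random section of $K$ of dimension $n - k$ has diameter at most $C^{n/k}$ with probability at least $1 - e^{-cn}$.
   Context: A convex body $K \subset \mathbb{R}^n$ is symmetric if $K = -K$. A section of $K$ of dimension $m$ is a set $K \cap E$, where $E$ is an $m$-dimensional linear subspace of $\mathbb{R}^n$. Diameters are Euclidean. A random section of dimension $m$ is $K \cap E$ with $E$ distributed according to the normalized Haar (rotation invariant) measure on the Grassmannian $G_{n,m}$ of $m$-dimensional subspaces of $\mathbb{R}^n$. "Absolute constant" means a number independent of $n, k, K$. *)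

theory Defs
  imports "HOL-Probability.Probability"
begin

text \<open>
  The constants of the theorem are uniform in the dimension, so the dimension has to be a number
  and not a type. All the spaces \<open>\<real>\<^sup>n\<close> are therefore taken inside the one inner product space of
  finitely supported real sequences, as the subspaces \<open>euclid n\<close> of sequences that
  vanish from index \<open>n\<close> on. (The library type of finitely supported functions
  carries the \<open>\<ell>\<^sub>1\<close> norm and is of no use here.)
\<close>

typedef fseq = "{x :: nat \<Rightarrow> real. finite {i. x i \<noteq> 0}}"
  morphisms coord Abs_fseq
  by (rule exI[of _ "\<lambda>_. 0"]) simp

setup_lifting type_definition_fseq

lemma finite_coord: "finite {i. coord x i \<noteq> 0}"
  using coord by auto

lemma fseq_eqI: "(\<And>i. coord x i = coord y i) \<Longrightarrow> x = y"
  by (simp add: coord_inject[symmetric] fun_eq_iff)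

instantiation fseq :: real_vector
begin

lift_definition zero_fseq :: fseq is "\<lambda>_. 0" by simp

lift_definition plus_fseq :: "fseq \<Rightarrow> fseq \<Rightarrow> fseq" is "\<lambda>x y i. x i + y i"
  subgoal for x y
    by (rule finite_subset[of _ "{i. x i \<noteq> 0} \<union> {i. y i \<noteq> 0}"]) auto
  done

lift_definition minus_fseq :: "fseq \<Rightarrow> fseq \<Rightarrow> fseq" is "\<lambda>x y i. x i - y i"
  subgoal for x y
    by (rule finite_subset[of _ "{i. x i \<noteq> 0} \<union> {i. y i \<noteq> 0}"]) auto
  done

lift_definition uminus_fseq :: "fseq \<Rightarrow> fseq" is "\<lambda>x i. - x i"
  by simp

lift_definition scaleR_fseq :: "real \<Rightarrow> fseq \<Rightarrow> fseq" is "\<lambda>a x i. a * x i"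
  by (erule rev_finite_subset) auto

instance
  by standard (transfer; simp add: fun_eq_iff algebra_simps)+

end

instantiation fseq :: real_inner
begin

definition inner_fseq :: "fseq \<Rightarrow> fseq \<Rightarrow> real"
  where "inner_fseq x y = (\<Sum>i | coord x i \<noteq> 0. coord x i * coord y i)"

definition norm_fseq :: "fseq \<Rightarrow> real"
  where "norm_fseq x = sqrt (inner x x)"

definition dist_fseq :: "fseq \<Rightarrow> fseq \<Rightarrow> real"
  where "dist_fseq x y = norm (x - y)"

definition sgn_fseq :: "fseq \<Rightarrow> fseq"
  where "sgn_fseq x = x /\<^sub>R norm x"

definition uniformity_fseq :: "(fseq \<times> fseq) filter"
  where "uniformity_fseq = (INF e\<in>{0<..}. principal {(x, y). dist x y < e})"

definition open_fseq :: "fseq set \<Rightarrow> bool"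
  where "open_fseq U \<longleftrightarrow> (\<forall>x\<in>U. eventually (\<lambda>(x', y). x' = x \<longrightarrow> y \<in> U) uniformity)"

lemma inner_fseq_eq_sum:
  assumes "finite A" "{i. coord x i \<noteq> 0} \<subseteq> A"
  shows "inner x y = (\<Sum>i\<in>A. coord x i * coord y i)"
  unfolding inner_fseq_def by (rule sum.mono_neutral_left) (use assms in auto)

instance
proof
  fix x y z :: fseq and r :: real
  let ?A = "{i. coord x i \<noteq> 0} \<union> {i. coord y i \<noteq> 0}"
  have fin: "finite ?A" by (simp add: finite_coord)
  have sub: "{i. coord (x + y) i \<noteq> 0} \<subseteq> ?A" by (auto simp: plus_fseq.rep_eq)
  show "inner x y = inner y x"
    by (simp add: inner_fseq_eq_sum[OF fin] mult.commute)
  show "inner (x + y) z = inner x z + inner y z"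
    by (simp add: inner_fseq_eq_sum[OF fin] inner_fseq_eq_sum[OF fin sub] plus_fseq.rep_eq
        distrib_right sum.distrib)
  have "{i. coord (r *\<^sub>R x) i \<noteq> 0} \<subseteq> {i. coord x i \<noteq> 0}" by (auto simp: scaleR_fseq.rep_eq)
  from inner_fseq_eq_sum[OF finite_coord this]
  show "inner (r *\<^sub>R x) y = r * inner x y"
    by (simp add: inner_fseq_def[of x y] scaleR_fseq.rep_eq sum_distrib_left mult.assoc)
  show "0 \<le> inner x x"
    unfolding inner_fseq_def by (rule sum_nonneg) simp
  show "inner x x = 0 \<longleftrightarrow> x = 0"
  proof
    assume "inner x x = 0"
    then have "\<forall>i\<in>{i. coord x i \<noteq> 0}. coord x i * coord x i = 0"
      unfolding inner_fseq_def by (subst (asm) sum_nonneg_eq_0_iff) (auto simp: finite_coord)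
    then show "x = 0" by (intro fseq_eqI) (auto simp: zero_fseq.rep_eq)
  qed (simp add: inner_fseq_def zero_fseq.rep_eq)
qed (simp_all add: norm_fseq_def dist_fseq_def sgn_fseq_def uniformity_fseq_def open_fseq_def)

end

definition euclid :: "nat \<Rightarrow> fseq set"
  where "euclid n = {x. \<forall>i\<ge>n. coord x i = 0}"

definition symmetric_convex_body :: "nat \<Rightarrow> fseq set \<Rightarrow> bool"
  where "symmetric_convex_body n K \<longleftrightarrow>
    K \<subseteq> euclid n \<and> convex K \<and> compact K \<and> top_of_set (euclid n) interior_of K \<noteq> {} \<and>
    K = uminus ` K"

definition grassmannian :: "nat \<Rightarrow> nat \<Rightarrow> fseq set set"
  where "grassmannian n m = {E. subspace E \<and> E \<subseteq> euclid n \<and> dim E = m}"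

text \<open>
  The gap (aperture) metric on the subspaces of \<open>\<real>\<^sup>n\<close>, that is, the operator norm of the
  difference of the orthogonal projections. It induces the usual topology of the Grassmannian.
\<close>

definition gap :: "fseq set \<Rightarrow> fseq set \<Rightarrow> real"
  where "gap E F = max (SUP x\<in>E \<inter> cball 0 1. infdist x F) (SUP x\<in>F \<inter> cball 0 1. infdist x E)"

definition grassmannian_borel :: "nat \<Rightarrow> nat \<Rightarrow> fseq set measure"
  where "grassmannian_borel n m = sigma (grassmannian n m)
    {U. U \<subseteq> grassmannian n m \<and>
        (\<forall>E\<in>U. \<exists>\<epsilon>>0. \<forall>F\<in>grassmannian n m. gap E F < \<epsilon> \<longrightarrow> F \<in> U)}"

text \<open>
  A rotation of \<open>\<real>\<^sup>n\<close> is given as an orthogonal map of the ambient sequence space that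
  maps \<open>euclid n\<close> onto itself; every element of \<open>O(n)\<close> is the restriction of such a map
  (extend it by the identity on the other coordinates).
\<close>

definition rotations :: "nat \<Rightarrow> (fseq \<Rightarrow> fseq) set"
  where "rotations n = {g. orthogonal_transformation g \<and> g ` euclid n = euclid n}"

text \<open>
  Normalized Haar measure on the Grassmannian, given by the properties that determine it:
  it is the unique rotation invariant Borel probability measure there.
\<close>

definition haar_grassmannian :: "nat \<Rightarrow> nat \<Rightarrow> fseq set measure \<Rightarrow> bool"
  where "haar_grassmannian n m \<mu> \<longleftrightarrow>
    prob_space \<mu> \<and> space \<mu> = grassmannian n m \<and> sets \<mu> = sets (grassmannian_borel n m) \<and>
    (\<forall>g\<in>rotations n. \<forall>\<A>\<in>sets \<mu>. emeasure \<mu> ((`) g ` \<A>) = emeasure \<mu> \<A>)"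

end

theory Submission
  imports Defs
begin

text \<open>
  Both parts are instances of one estimate: if \<open>K\<close> has a section of dimension \<open>d\<close> and diameter at
  most \<open>1\<close>, and \<open>\<epsilon> \<le> 1\<close>, then a random section of dimension \<open>m \<le> d\<close> has a diameter above \<open>8 / \<epsilon>\<close> with
  probability at most \<open>2304\<^sup>n \<epsilon>\<^sup>d\<^sup>-\<^sup>m\<close> (\<open>random_section_diameter_tail\<close>). With \<open>j = \<lfloor>k / 2\<rfloor>\<close> the pair
  \<open>(d, m)\<close> is \<open>(k, j)\<close> in the first part and \<open>(n - j, n - k)\<close> in the second, so that
  \<open>d - m = k - j \<ge> k / 2\<close> both times, and \<open>\<epsilon> = 8 / C\<^sup>n\<^sup>/\<^sup>k\<close> makes the bound exponentially small in
  \<open>n\<close> when \<open>C\<close> is large.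

  The estimate is a union bound. Let \<open>R = 4 / \<epsilon>\<close> and \<open>K' = R\<^sup>-\<^sup>1 K \<inter> B\<close>, where \<open>B\<close> is the unit ball.
  If the section by \<open>F\<close> is too long, then \<open>F\<close> contains a unit vector of \<open>K'\<close>, and lies within
  \<open>\<epsilon>\<close> of a point of a fixed \<open>\<epsilon>\<close>-net of the unit vectors of \<open>K'\<close>. Two facts are needed.

  The net has at most \<open>(16 / \<epsilon>)\<^sup>n\<^sup>-\<^sup>d\<close> points (\<open>packing_bound_of_bounded_section\<close>). Let \<open>E\<close> be the
  subspace that yields the bounded section. Modulo \<open>E\<close> the body \<open>K'\<close> is a convex body of dimension
  \<open>n - d\<close>, so it contains at most \<open>(4 / s)\<^sup>n\<^sup>-\<^sup>d\<close> points that are \<open>s\<close>-separated in its own norm. If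
  two points of \<open>K'\<close> are not separated in this sense, say \<open>x - y = s k + w\<close> with \<open>k \<in> K'\<close> and \<open>w \<in> E\<close>,
  then \<open>w\<close> lies in \<open>(2 + s) K' \<inter> E\<close> and so is short, because \<open>K' \<inter> E\<close> is contained in
  \<open>R\<^sup>-\<^sup>1 B\<close>; hence \<open>x\<close> and \<open>y\<close> are close. To measure the separation in the norm of \<open>K'\<close> itself, and
  not in the Euclidean norm of the projection, is what makes this work for a body of any shape.

  A random \<open>m\<close>-dimensional subspace comes within \<open>\<epsilon>\<close> of a given unit vector with probability at
  most \<open>144\<^sup>n \<epsilon>\<^sup>n\<^sup>-\<^sup>m\<close> (\<open>haar_prob_near_unit_vector\<close>). By invariance the vector may be averaged over a
  net of the ball, and then the subspace may be held fixed and the points near it counted.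

  Packing and covering numbers are usually compared through volumes. As the dimension is a
  variable, the comparison is made here by self-similarity: iterating a configuration inside itself
  raises its cardinality and its scale to the same power, so a bound with the right exponent and
  any constant implies the one with a good constant (\<open>packing_bound_self_improves\<close>,
  \<open>covering_bound_ball\<close>).

  The probabilities are meaningful because the events are closed in the gap topology
  (\<open>infdist_le_event_measurable\<close>, \<open>section_diameter_event_measurable\<close>).
\<close>

section \<open>Packing numbers of symmetric convex sets\<close>

definition separated_by :: "'a::ab_group_add set \<Rightarrow> 'a set \<Rightarrow> bool"
  where "separated_by A X \<longleftrightarrow> (\<forall>x\<in>X. \<forall>y\<in>X. x \<noteq> y \<longrightarrow> x - y \<notin> A)"

lemma separated_byD: "separated_by A X \<Longrightarrow> x \<in> X \<Longrightarrow> y \<in> X \<Longrightarrow> x - y \<in> A \<Longrightarrow> x = y"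
  by (auto simp: separated_by_def)

lemma convex_scaleR_mem:
  fixes A :: "'a::real_vector set"
  assumes "convex A" "0 \<in> A" "a \<in> A" "0 \<le> t" "t \<le> 1"
  shows "t *\<^sub>R a \<in> A"
  using convexD[OF assms(1,3,2), of t "1 - t"] assms by simp

lemma convex_combination2_mem:
  fixes A :: "'a::real_vector set"
  assumes A: "convex A" "0 \<in> A" and ab: "a \<in> A" "b \<in> A"
    and c: "0 \<le> \<alpha>" "0 \<le> \<beta>" "\<alpha> + \<beta> \<le> 1"
  shows "\<alpha> *\<^sub>R a + \<beta> *\<^sub>R b \<in> A"
proof (cases "\<alpha> + \<beta> = 0")
  case False
  then have pos: "0 < \<alpha> + \<beta>" using c by simp
  have "(\<alpha> / (\<alpha> + \<beta>)) *\<^sub>R a + (\<beta> / (\<alpha> + \<beta>)) *\<^sub>R b \<in> A"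
    using c pos by (intro convexD[OF A(1) ab]) (simp_all add: add_divide_distrib[symmetric])
  from convex_scaleR_mem[OF A this, of "\<alpha> + \<beta>"] show ?thesis
    using c pos by (simp add: scaleR_right_distrib)
next
  case True
  then have "\<alpha> = 0" "\<beta> = 0" using c by auto
  then show ?thesis using A by simp
qed

lemma convex_combination3_mem:
  fixes A :: "'a::real_vector set"
  assumes A: "convex A" "0 \<in> A" and abc: "a \<in> A" "b \<in> A" "c \<in> A"
    and c: "0 \<le> \<alpha>" "0 \<le> \<beta>" "0 \<le> \<gamma>" "\<alpha> + \<beta> + \<gamma> \<le> 1"
  shows "\<alpha> *\<^sub>R a + \<beta> *\<^sub>R b + \<gamma> *\<^sub>R c \<in> A"
proof (cases "\<alpha> + \<beta> = 0")
  case True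
  then have "\<alpha> = 0" "\<beta> = 0" using c by auto
  then show ?thesis using convex_scaleR_mem[OF A abc(3), of \<gamma>] c by simp
next
  case False
  then have pos: "0 < \<alpha> + \<beta>" using c by simp
  have "(\<alpha> / (\<alpha> + \<beta>)) *\<^sub>R a + (\<beta> / (\<alpha> + \<beta>)) *\<^sub>R b \<in> A"
    using c pos by (intro convexD[OF A(1) abc(1,2)]) (simp_all add: add_divide_distrib[symmetric])
  from convex_combination2_mem[OF A this abc(3), of "\<alpha> + \<beta>" \<gamma>] show ?thesis
    using c pos by (simp add: scaleR_right_distrib)
qed

lemma le_if_powers_le_mult_powers:
  fixes a b c :: real
  assumes "0 \<le> a" "0 < b" and le: "\<And>j::nat. a ^ j \<le> c * b ^ j"
  shows "a \<le> b"
proof (rule ccontr)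
  assume "\<not> a \<le> b"
  then have "1 < a / b" using assms by simp
  then obtain j where "c < (a / b) ^ j" using real_arch_pow by blast
  then have "c * b ^ j < a ^ j" using assms by (simp add: power_divide field_simps)
  then show False using le[of j] by simp
qed

text \<open>
  The exponent of a bound on packing numbers improves its constant. If \<open>X\<close> is
  \<open>s\<close>-separated, the points \<open>(1 - s/4) x + (s/4) y\<close> with \<open>x \<in> X\<close> and \<open>y\<close> in
  an \<open>r\<close>-separated set are \<open>(s/4) r\<close>-separated and remain in \<open>A\<close>. Iteration
  yields \<open>(card X)\<^sup>j\<close> points that are \<open>(s/4)\<^sup>j\<close>-separated; in the limit
  \<open>j \<rightarrow> \<infinity>\<close> the constant \<open>L\<close>, however large, disappears. This replaces the
  comparison of volumes.
\<close>

lemma packing_bound_self_improves: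
  fixes A :: "'a::real_vector set"
  assumes conv: "convex A" and sym: "\<And>x. x \<in> A \<Longrightarrow> - x \<in> A" and zero: "0 \<in> A"
    and crude: "\<And>r Y. \<lbrakk>0 < r; r \<le> 1; finite Y; Y \<subseteq> A; separated_by ((*\<^sub>R) r ` A) Y\<rbrakk>
      \<Longrightarrow> real (card Y) \<le> (L / r) ^ N"
    and s: "0 < s" "s \<le> 1"
    and X: "finite X" "X \<subseteq> A" "separated_by ((*\<^sub>R) s ` A) X"
  shows "real (card X) \<le> (4 / s) ^ N"
proof (rule le_if_powers_le_mult_powers)
  \<comment> \<open>The weight \<open>q\<close> has to satisfy \<open>3 q \<le> s (1 - q)\<close>, which holds for all \<open>s \<le> 1\<close> if \<open>q = s / 4\<close>.\<close>
  define q where "q = s / 4"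
  have q: "0 < q" "q \<le> 1 / 4" "s = 4 * q" using s by (auto simp: q_def)
  have ex: "\<exists>Y. finite Y \<and> Y \<subseteq> A \<and> separated_by ((*\<^sub>R) (q ^ j) ` A) Y \<and> card Y = card X ^ j" for j
  proof (induction j)
    case 0
    show ?case using zero by (intro exI[of _ "{0}"]) (auto simp: separated_by_def)
  next
    case (Suc j)
    then obtain Y where Y: "finite Y" "Y \<subseteq> A" "separated_by ((*\<^sub>R) (q ^ j) ` A) Y"
      "card Y = card X ^ j" by blast
    define \<phi> where "\<phi> = (\<lambda>(x :: 'a, y :: 'a). (1 - q) *\<^sub>R x + q *\<^sub>R y)"
    have sep: "x = x' \<and> y = y'"
      if xy: "x \<in> X" "y \<in> Y" "x' \<in> X" "y' \<in> Y"
        and d: "\<phi> (x, y) - \<phi> (x', y') \<in> (*\<^sub>R) (q ^ Suc j) ` A" for x y x' y'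
    proof -
      from d obtain a where a: "a \<in> A" "\<phi> (x, y) - \<phi> (x', y') = q ^ Suc j *\<^sub>R a" by blast
      have qj: "q ^ Suc j \<le> q" "0 \<le> q ^ Suc j"
        using q by (auto simp: mult_le_cancel_left1 power_le_one)
      define u where "u = (q ^ Suc j / (s * (1 - q))) *\<^sub>R a + (q / (s * (1 - q))) *\<^sub>R (- y)
        + (q / (s * (1 - q))) *\<^sub>R y'"
      have "u \<in> A"
        unfolding u_def
      proof (rule convex_combination3_mem[OF conv zero])
        have "q ^ Suc j + q + q \<le> 3 * q" using qj by simp
        also have "\<dots> \<le> s * (1 - q)"
          using q mult_left_mono[of q "1/4" q] by (simp add: algebra_simps)
        finally have "(q ^ Suc j + q + q) / (s * (1 - q)) \<le> 1"
          using q by (simp add: divide_le_eq_1)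
        then show "q ^ Suc j / (s * (1 - q)) + q / (s * (1 - q)) + q / (s * (1 - q)) \<le> 1"
          by (simp add: add_divide_distrib)
      qed (use a xy Y X sym q in auto)
      moreover have "x - x' = s *\<^sub>R u"
      proof -
        have "(1 - q) *\<^sub>R (x - x') = q ^ Suc j *\<^sub>R a - q *\<^sub>R y + q *\<^sub>R y'"
          using a(2) by (simp add: \<phi>_def algebra_simps)
        then have "(1 / (1 - q)) *\<^sub>R ((1 - q) *\<^sub>R (x - x'))
            = (1 / (1 - q)) *\<^sub>R (q ^ Suc j *\<^sub>R a - q *\<^sub>R y + q *\<^sub>R y')" by simp
        then have "x - x' = (1 / (1 - q)) *\<^sub>R (q ^ Suc j *\<^sub>R a - q *\<^sub>R y + q *\<^sub>R y')"
          using q by simp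
        then show ?thesis
          using s by (simp add: u_def scaleR_right_distrib scaleR_right_diff_distrib)
      qed
      ultimately have xx: "x = x'" using separated_byD[OF X(3)] xy by blast
      have "q *\<^sub>R (y - y') = q *\<^sub>R (q ^ j *\<^sub>R a)"
        using a(2) by (simp add: \<phi>_def xx algebra_simps)
      then have "y - y' = q ^ j *\<^sub>R a" using q by (metis less_irrefl scaleR_cancel_left)
      then have "y = y'" using separated_byD[OF Y(3)] xy a(1) by blast
      with xx show ?thesis by simp
    qed
    have "inj_on \<phi> (X \<times> Y)"
    proof (rule inj_onI, clarify)
      fix x y x' y' assume "x \<in> X" "y \<in> Y" "x' \<in> X" "y' \<in> Y" "\<phi> (x, y) = \<phi> (x', y')"
      moreover have "0 \<in> (*\<^sub>R) (q ^ Suc j) ` A" using zero by (metis image_eqI scaleR_zero_right)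
      ultimately show "x = x' \<and> y = y'" using sep by simp
    qed
    then have "card (\<phi> ` (X \<times> Y)) = card X ^ Suc j"
      by (simp add: card_image card_cartesian_product Y(4))
    moreover have "\<phi> ` (X \<times> Y) \<subseteq> A"
    proof clarify
      fix x y assume "x \<in> X" "y \<in> Y"
      then show "\<phi> (x, y) \<in> A"
        using convexD[OF conv, of x y "1 - q" q] X Y q by (auto simp: \<phi>_def)
    qed
    moreover have "separated_by ((*\<^sub>R) (q ^ Suc j) ` A) (\<phi> ` (X \<times> Y))"
      unfolding separated_by_def using sep by fast
    ultimately show ?case using X(1) Y(1) by (intro exI[of _ "\<phi> ` (X \<times> Y)"]) auto
  qed
  fix j :: nat
  obtain Y where Y: "finite Y" "Y \<subseteq> A" "separated_by ((*\<^sub>R) (q ^ j) ` A) Y"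
    "card Y = card X ^ j" using ex[of j] by blast
  have "real (card Y) \<le> (L / q ^ j) ^ N"
    using q by (intro crude) (auto simp: Y power_le_one)
  then show "real (card X) ^ j \<le> L ^ N * ((4 / s) ^ N) ^ j"
    by (simp add: Y(4) q power_divide power_mult[symmetric] mult.commute)
qed (use s in auto)

text \<open>
  Rounding the values of the functionals \<open>f i\<close> to multiples of \<open>\<eta> * r\<close> separates the points,
  because two points with equal roundings differ by an element of \<open>r A\<close>.
\<close>

lemma crude_packing_bound:
  fixes f :: "'i \<Rightarrow> 'a::real_vector \<Rightarrow> real"
  assumes I: "finite I" and bdd: "\<And>i x. \<lbrakk>i \<in> I; x \<in> A\<rbrakk> \<Longrightarrow> \<bar>f i x\<bar> \<le> M" and "0 \<le> M" and "0 < \<eta>"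
    and small: "\<And>x y. \<lbrakk>x \<in> A; y \<in> A; \<And>i. i \<in> I \<Longrightarrow> \<bar>f i x - f i y\<bar> \<le> \<eta> * r\<rbrakk>
      \<Longrightarrow> x - y \<in> (*\<^sub>R) r ` A"
    and r: "0 < r" "r \<le> 1"
    and Y: "finite Y" "Y \<subseteq> A" "separated_by ((*\<^sub>R) r ` A) Y"
  shows "real (card Y) \<le> ((2 * M / \<eta> + 2) / r) ^ card I"
proof -
  define \<phi> where "\<phi> y = (\<lambda>i\<in>I. \<lfloor>f i y / (\<eta> * r)\<rfloor>)" for y
  define q where "q = M / (\<eta> * r)"
  have "0 \<le> q" using assms by (simp add: q_def)
  define T where "T = {\<lfloor>- q\<rfloor>..\<lfloor>q\<rfloor>}"
  have "inj_on \<phi> Y"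
  proof (rule inj_onI)
    fix x y assume xy: "x \<in> Y" "y \<in> Y" "\<phi> x = \<phi> y"
    have "\<bar>f i x - f i y\<bar> \<le> \<eta> * r" if "i \<in> I" for i
    proof -
      have "\<lfloor>f i x / (\<eta> * r)\<rfloor> = \<lfloor>f i y / (\<eta> * r)\<rfloor>"
        using fun_cong[OF xy(3), of i] that by (simp add: \<phi>_def)
      then have "\<bar>f i x / (\<eta> * r) - f i y / (\<eta> * r)\<bar> \<le> 1" by linarith
      then have "\<bar>(f i x - f i y) / (\<eta> * r)\<bar> \<le> 1" by (simp add: diff_divide_distrib)
      then show ?thesis using \<open>0 < \<eta>\<close> r by (simp add: abs_mult field_simps)
    qed
    then show "x = y" using small Y xy separated_byD[OF Y(3)] by blast
  qed
  moreover have "\<phi> ` Y \<subseteq> (\<Pi>\<^sub>E i\<in>I. T)"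
  proof
    fix g assume "g \<in> \<phi> ` Y"
    then obtain y where y: "y \<in> Y" "g = \<phi> y" by blast
    have "\<lfloor>f i y / (\<eta> * r)\<rfloor> \<in> T" if "i \<in> I" for i
    proof -
      have b: "\<bar>f i y\<bar> \<le> M" using bdd that y Y by blast
      have "- q \<le> f i y / (\<eta> * r)" "f i y / (\<eta> * r) \<le> q"
        unfolding q_def minus_divide_left using b \<open>0 < \<eta>\<close> r by (intro divide_right_mono; simp)+
      then show ?thesis by (simp add: T_def floor_mono)
    qed
    then show "g \<in> (\<Pi>\<^sub>E i\<in>I. T)" by (simp add: y \<phi>_def PiE_iff)
  qed
  moreover have "finite (\<Pi>\<^sub>E i\<in>I. T)" using I by (simp add: T_def finite_PiE)
  ultimately have "card Y \<le> card (\<Pi>\<^sub>E i\<in>I. T)" by (rule card_inj_on_le)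
  also have "\<dots> = card T ^ card I" using I by (simp add: card_PiE)
  finally have "real (card Y) \<le> real (card T) ^ card I" by (metis of_nat_le_iff of_nat_power)
  also have "real (card T) \<le> 2 * q + 2"
    using \<open>0 \<le> q\<close> by (simp add: T_def) linarith
  then have "real (card T) ^ card I \<le> (2 * q + 2) ^ card I" by (intro power_mono) auto
  also have "2 * q + 2 \<le> (2 * M / \<eta> + 2) / r"
    using r \<open>0 < \<eta>\<close> by (simp add: q_def field_simps)
  then have "(2 * q + 2) ^ card I \<le> ((2 * M / \<eta> + 2) / r) ^ card I"
    using \<open>0 \<le> q\<close> by (intro power_mono) auto
  finally show ?thesis .
qed

definition separated_net :: "real \<Rightarrow> 'a::metric_space set \<Rightarrow> 'a set \<Rightarrow> bool"
  where "separated_net \<epsilon> S X \<longleftrightarrow> finite X \<and> X \<subseteq> S \<and> pairwise (\<lambda>x y. \<epsilon> < dist x y) X \<and>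
    (\<forall>y\<in>S. \<exists>x\<in>X. dist x y \<le> \<epsilon>)"

lemma separated_net_exists:
  fixes S :: "'a::metric_space set"
  assumes bound: "\<And>X. \<lbrakk>finite X; X \<subseteq> S; pairwise (\<lambda>x y. \<epsilon> < dist x y) X\<rbrakk> \<Longrightarrow> real (card X) \<le> b"
    and "0 \<le> \<epsilon>"
  shows "\<exists>X. separated_net \<epsilon> S X"
proof -
  let ?P = "\<lambda>k. \<exists>X. finite X \<and> X \<subseteq> S \<and> pairwise (\<lambda>x y. \<epsilon> < dist x y) X \<and> card X = k"
  have P0: "?P 0" by (intro exI[of _ "{}"]) auto
  have le: "\<And>k. ?P k \<Longrightarrow> k \<le> nat \<lfloor>b\<rfloor>" using bound by (auto simp: le_nat_floor)
  define k where "k = Greatest ?P"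
  have k: "?P k" "\<forall>l. ?P l \<longrightarrow> l \<le> k"
    unfolding k_def using GreatestI_nat[of ?P, OF P0 le] Greatest_le_nat[of ?P, OF _ le] by blast+
  from k(1) obtain X where X: "finite X" "X \<subseteq> S" "pairwise (\<lambda>x y. \<epsilon> < dist x y) X" "card X = k" by blast
  have "\<exists>x\<in>X. dist x y \<le> \<epsilon>" if "y \<in> S" for y
  proof (rule ccontr)
    assume "\<not> ?thesis"
    then have far: "\<forall>x\<in>X. \<epsilon> < dist x y" by auto
    then have "y \<notin> X" using \<open>0 \<le> \<epsilon>\<close> by auto
    moreover have "pairwise (\<lambda>x y. \<epsilon> < dist x y) (insert y X)"
      using far X(3) by (auto simp: pairwise_insert dist_commute)
    ultimately have "?P (Suc k)"
      using X that by (intro exI[of _ "insert y X"]) auto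
    then show False using k(2) by fastforce
  qed
  then show ?thesis unfolding separated_net_def using X by blast
qed

section \<open>Finite-dimensional subspaces of the sequence space\<close>

lift_definition unit_vec :: "nat \<Rightarrow> fseq" is "\<lambda>i j. if j = i then 1 else 0"
  by simp

lemma coord_sum: "coord (\<Sum>i\<in>I. x i) j = (\<Sum>i\<in>I. coord (x i) j)"
  by (induction I rule: infinite_finite_induct) (auto simp: zero_fseq.rep_eq plus_fseq.rep_eq)

lemma subspace_euclid: "subspace (euclid n)"
  by (auto simp: subspace_def euclid_def zero_fseq.rep_eq plus_fseq.rep_eq scaleR_fseq.rep_eq)

lemma unit_vec_in_euclid: "i < n \<Longrightarrow> unit_vec i \<in> euclid n"
  by (auto simp: euclid_def unit_vec.rep_eq)

lemma coord_unit_vec_combination: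
  "coord (\<Sum>i<n. a i *\<^sub>R unit_vec i) j = (if j < n then a j else 0)"
proof -
  have "coord (\<Sum>i<n. a i *\<^sub>R unit_vec i) j = (\<Sum>i<n. if j = i then a i else 0)"
    unfolding coord_sum scaleR_fseq.rep_eq unit_vec.rep_eq by (rule sum.cong) auto
  then show ?thesis by simp
qed

lemma euclid_expansion:
  assumes "x \<in> euclid n"
  shows "x = (\<Sum>i<n. coord x i *\<^sub>R unit_vec i)"
  using assms by (intro fseq_eqI) (auto simp: coord_unit_vec_combination euclid_def)

lemma inj_unit_vec: "inj unit_vec"
proof (rule injI)
  fix i j assume "unit_vec i = unit_vec j"
  then have "coord (unit_vec i) i = coord (unit_vec j) i" by simp
  then show "i = j" by (simp add: unit_vec.rep_eq split: if_splits)
qed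

lemma euclid_eq_span: "euclid n = span (unit_vec ` {..<n})"
proof
  show "euclid n \<subseteq> span (unit_vec ` {..<n})"
  proof
    fix x assume "x \<in> euclid n"
    then have "x = (\<Sum>i<n. coord x i *\<^sub>R unit_vec i)" by (rule euclid_expansion)
    also have "\<dots> \<in> span (unit_vec ` {..<n})"
      by (intro span_sum span_scale span_base) auto
    finally show "x \<in> span (unit_vec ` {..<n})" .
  qed
  show "span (unit_vec ` {..<n}) \<subseteq> euclid n"
    by (rule span_minimal) (auto simp: subspace_euclid unit_vec_in_euclid)
qed

lemma independent_unit_vecs: "independent (unit_vec ` {..<n})"
proof (rule independent_if_scalars_zero)
  fix f x assume 0: "(\<Sum>x\<in>unit_vec ` {..<n}. f x *\<^sub>R x) = 0" and "x \<in> unit_vec ` {..<n}"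
  then obtain i where i: "i < n" "x = unit_vec i" by auto
  have "0 = (\<Sum>j<n. f (unit_vec j) *\<^sub>R unit_vec j)"
    using 0 by (subst (asm) sum.reindex) (auto intro: inj_on_subset[OF inj_unit_vec])
  then have "0 = coord (\<Sum>j<n. f (unit_vec j) *\<^sub>R unit_vec j) i"
    by (metis zero_fseq.rep_eq)
  also have "\<dots> = f x" using i by (simp add: coord_unit_vec_combination)
  finally show "f x = 0" by simp
qed simp

lemma dim_euclid: "dim (euclid n) = n"
proof -
  have "dim (euclid n) = card (unit_vec ` {..<n})"
    using dim_eq_card[of "unit_vec ` {..<n}" "euclid n"] independent_unit_vecs
    by (simp add: euclid_eq_span span_span)
  also have "\<dots> = n" using card_image[OF inj_on_subset[OF inj_unit_vec]] by auto
  finally show ?thesis .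
qed

lemma abs_coord_le_norm: "\<bar>coord x i\<bar> \<le> norm x"
proof (cases "coord x i = 0")
  case False
  have "(coord x i)\<^sup>2 \<le> (\<Sum>j | coord x j \<noteq> 0. coord x j * coord x j)"
    unfolding power2_eq_square
    by (rule member_le_sum) (use False finite_coord in auto)
  then have "sqrt ((coord x i)\<^sup>2) \<le> norm x"
    unfolding norm_eq_sqrt_inner inner_fseq_def by (rule real_sqrt_le_mono)
  then show ?thesis by simp
qed simp

lemma norm_unit_vec: "norm (unit_vec i) = 1"
proof -
  have "{j. coord (unit_vec i) j \<noteq> 0} = {i}" by (auto simp: unit_vec.rep_eq)
  then show ?thesis
    by (simp add: norm_eq_sqrt_inner inner_fseq_def unit_vec.rep_eq)
qed

lemma finite_independent_in_euclid:
  assumes "independent B" "B \<subseteq> euclid n"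
  shows "finite B"
  using independent_span_bound[of "unit_vec ` {..<n}" B] assms by (simp add: euclid_eq_span)

lemma linear_functional_bounded_on_euclid:
  fixes f :: "fseq \<Rightarrow> real"
  assumes "linear f"
  obtains M where "0 \<le> M" "\<And>x. x \<in> euclid n \<Longrightarrow> \<bar>f x\<bar> \<le> M * norm x"
proof
  show "0 \<le> (\<Sum>i<n. \<bar>f (unit_vec i)\<bar>)" by (simp add: sum_nonneg)
  fix x assume x: "x \<in> euclid n"
  have "f x = f (\<Sum>i<n. coord x i *\<^sub>R unit_vec i)" using euclid_expansion[OF x] by simp
  also have "\<dots> = (\<Sum>i<n. coord x i * f (unit_vec i))"
    using assms by (simp add: linear_sum linear_cmul)
  finally have "\<bar>f x\<bar> \<le> (\<Sum>i<n. \<bar>coord x i * f (unit_vec i)\<bar>)" using sum_abs by metis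
  also have "\<dots> \<le> (\<Sum>i<n. norm x * \<bar>f (unit_vec i)\<bar>)"
    by (intro sum_mono) (auto simp: abs_mult intro: mult_right_mono abs_coord_le_norm)
  finally show "\<bar>f x\<bar> \<le> (\<Sum>i<n. \<bar>f (unit_vec i)\<bar>) * norm x"
    by (simp add: sum_distrib_left mult.commute)
qed

text \<open>
  Only the codimension of \<open>W\<close> enters, because the coordinates of a complement of \<open>W\<close> control
  membership in \<open>K + W\<close>. The set \<open>K + W\<close> is the preimage in \<open>V\<close> of the image of \<open>K\<close>
  in the quotient \<open>V / W\<close>, so no type for the quotient is needed.
\<close>

lemma packing_bound_mod_subspace:
  assumes V: "subspace V" "V \<subseteq> euclid n" and W: "subspace W" "W \<subseteq> V"
    and K: "convex K" "\<And>x. x \<in> K \<Longrightarrow> - x \<in> K" "K \<subseteq> V" "K \<subseteq> cball 0 \<rho>"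
    and ball: "0 < \<eta>" "V \<inter> cball 0 \<eta> \<subseteq> K"
    and s: "0 < s" "s \<le> 1"
    and X: "finite X" "X \<subseteq> K"
    and sep: "\<And>x y k w. \<lbrakk>x \<in> X; y \<in> X; k \<in> K; w \<in> W; x - y = s *\<^sub>R k + w\<rbrakk> \<Longrightarrow> x = y"
  shows "real (card X) \<le> (4 / s) ^ (dim V - dim W)"
proof -
  define A where "A = {k + w | k w. k \<in> K \<and> w \<in> W}"
  have K0: "0 \<in> K" using ball V by (auto simp: subspace_def)
  have W0: "0 \<in> W" using W by (auto simp: subspace_def)
  have "\<rho> \<ge> 0" using K0 K(4) by auto
  obtain B0 where B0: "B0 \<subseteq> W" "independent B0" "W \<subseteq> span B0" "card B0 = dim W"
    using basis_exists by blast
  have spanB0: "span B0 = W" using B0 W by (meson span_minimal subset_antisym)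
  obtain B where B: "B0 \<subseteq> B" "B \<subseteq> V" "independent B" "V \<subseteq> span B"
    using maximal_independent_subset_extend[of B0 V] B0 W by blast
  have spanB: "span B = V" using B V by (meson span_minimal subset_antisym)
  have finB: "finite B" using finite_independent_in_euclid B V by blast
  define I where "I = B - B0"
  have "dim V = card B" 
    by (rule dim_eq_card[OF _ B(3)]) (simp only: spanB span_eq_iff[THEN iffD2, OF V(1)])
  then have cardI: "card I = dim V - dim W"
    using B(1) B0(4) finB by (simp add: I_def card_Diff_subset finite_subset)
  have "\<exists>g::fseq \<Rightarrow> real. linear g \<and> (\<forall>x\<in>B. g x = (if x = b then 1 else 0))" for b
    by (rule linear_independent_extend[OF B(3)])
  then obtain f :: "fseq \<Rightarrow> fseq \<Rightarrow> real" where
    f: "\<And>b. linear (f b)" "\<And>b x. x \<in> B \<Longrightarrow> f b x = (if x = b then 1 else 0)"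
    by (metis (no_types))
  have expand: "x = (\<Sum>b\<in>B. f b x *\<^sub>R b)" if "x \<in> V" for x
  proof -
    have lin: "linear (\<lambda>x. \<Sum>b\<in>B. f b x *\<^sub>R b)"
      by (rule linearI)
        (simp_all only: linear_add[OF f(1)] linear_cmul[OF f(1)] scaleR_add_left sum.distrib
          scaleR_sum_right scaleR_scaleR real_scaleR_def)
    have id: "linear (\<lambda>x::fseq. x)" by (simp add: linear_iff)
    have eq: "x = (\<Sum>b\<in>B. f b x *\<^sub>R b)" if "x \<in> B" for x
    proof -
      have "(\<Sum>b\<in>B. f b x *\<^sub>R b) = (\<Sum>b\<in>B. if x = b then b else 0)"
        using that f(2)[OF that] by (intro sum.cong refl) simp
      also have "\<dots> = x" using finB that by simp
      finally show ?thesis by (rule sym)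
    qed
    have "x \<in> span B" using that by (simp only: spanB)
    with linear_eq_on_span[OF id lin, of B x] eq show ?thesis by blast
  qed
  have fW: "f b w = 0" if "b \<in> I" "w \<in> W" for b w
  proof -
    have "f b x = 0" if "x \<in> B0" for x
      using that \<open>b \<in> I\<close> B(1) f(2)[of x b] by (auto simp: I_def)
    moreover have "w \<in> span B0" using that by (simp only: spanB0)
    ultimately show ?thesis using linear_eq_0_on_span[OF f(1)] by blast
  qed
  have "\<exists>M. 0 \<le> M \<and> (\<forall>x\<in>euclid n. \<bar>f b x\<bar> \<le> M * norm x)" for b
    using linear_functional_bounded_on_euclid[OF f(1)] by metis
  then obtain m where m: "\<And>b. 0 \<le> m b" "\<And>b x. x \<in> euclid n \<Longrightarrow> \<bar>f b x\<bar> \<le> m b * norm x" by metis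
  define M where "M = (\<Sum>b\<in>I. m b) * \<rho>"
  have M0: "0 \<le> M" using \<open>\<rho> \<ge> 0\<close> m by (simp add: M_def sum_nonneg)
  have fA: "\<bar>f b x\<bar> \<le> M" if "b \<in> I" "x \<in> A" for b x
  proof -
    obtain k w where kw: "x = k + w" "k \<in> K" "w \<in> W" using \<open>x \<in> A\<close> by (auto simp: A_def)
    have "\<bar>f b x\<bar> = \<bar>f b k\<bar>" using kw fW[OF that(1)] by (simp add: linear_add[OF f(1)])
    also have "\<dots> \<le> m b * norm k" using kw K(3) V m(2) by blast
    also have "\<dots> \<le> m b * \<rho>" using kw K(4) m(1) by (intro mult_left_mono) auto
    also have "\<dots> \<le> M"
      unfolding M_def using that(1) finB m(1) \<open>\<rho> \<ge> 0\<close>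
      by (intro mult_right_mono member_le_sum) (auto simp: I_def)
    finally show ?thesis .
  qed
  define \<eta>' where "\<eta>' = \<eta> / (1 + (\<Sum>b\<in>I. norm b))"
  have den: "0 < 1 + (\<Sum>b\<in>I. norm b)" by (simp add: add_pos_nonneg sum_nonneg)
  then have \<eta>': "0 < \<eta>'" using ball by (simp add: \<eta>'_def)
  have AV: "A \<subseteq> V" using K(3) W(2) V(1) by (auto simp: A_def intro: subspace_add)
  have small: "x - y \<in> (*\<^sub>R) r ` A"
    if r: "0 < r" and xy: "x \<in> A" "y \<in> A" and le: "\<And>b. b \<in> I \<Longrightarrow> \<bar>f b x - f b y\<bar> \<le> \<eta>' * r" for r x y
  proof -
    define v where "v = x - y"
    have "v \<in> V" using xy AV V(1) by (auto simp: v_def intro: subspace_diff)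
    define k where "k = (\<Sum>b\<in>I. (f b v / r) *\<^sub>R b)"
    define w where "w = (1 / r) *\<^sub>R (\<Sum>b\<in>B0. f b v *\<^sub>R b)"
    have "v = (\<Sum>b\<in>I. f b v *\<^sub>R b) + (\<Sum>b\<in>B0. f b v *\<^sub>R b)"
      using expand[OF \<open>v \<in> V\<close>] sum.subset_diff[OF B(1) finB, of "\<lambda>b. f b v *\<^sub>R b"]
      by (simp add: I_def)
    then have v: "v = r *\<^sub>R (k + w)"
      using r by (simp add: k_def w_def scaleR_right_distrib scaleR_sum_right)
    have "w \<in> W" unfolding w_def spanB0[symmetric] by (intro span_scale span_sum span_base)
    have "k \<in> V" unfolding k_def spanB[symmetric]
      by (intro span_scale span_sum span_base) (auto simp: I_def)
    have "norm k \<le> (\<Sum>b\<in>I. \<eta>' * norm b)"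
      unfolding k_def
    proof (rule order.trans[OF norm_sum sum_mono])
      fix b assume "b \<in> I"
      then have "\<bar>f b v\<bar> \<le> \<eta>' * r" using le by (simp add: v_def linear_diff[OF f(1)])
      then have "\<bar>f b v / r\<bar> \<le> \<eta>'" using r by (simp add: field_simps)
      then show "norm ((f b v / r) *\<^sub>R b) \<le> \<eta>' * norm b" using mult_right_mono by fastforce
    qed
    also have "\<dots> = \<eta>' * (\<Sum>b\<in>I. norm b)" by (simp add: sum_distrib_left)
    also have "\<dots> \<le> \<eta>' * (1 + (\<Sum>b\<in>I. norm b))" using \<eta>' by simp
    also have "\<dots> = \<eta>" using den by (simp add: \<eta>'_def)
    finally have "k \<in> K" using ball \<open>k \<in> V\<close> by auto
    then show ?thesis using v \<open>w \<in> W\<close> by (auto simp: A_def v_def[symmetric])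
  qed
  show ?thesis
    unfolding cardI[symmetric]
  proof (rule packing_bound_self_improves[of A "2 * M / \<eta>' + 2"])
    show "convex A"
    proof -
      have "A = (\<Union>x\<in>K. \<Union>y\<in>W. {x + y})" by (auto simp: A_def)
      then show ?thesis using convex_sums[OF K(1) subspace_imp_convex[OF W(1)]] by simp
    qed
    show "- x \<in> A" if "x \<in> A" for x
    proof -
      obtain k w where "x = k + w" "k \<in> K" "w \<in> W" using \<open>x \<in> A\<close> by (auto simp: A_def)
      then have "- x = - k + - w" "- k \<in> K" "- w \<in> W" using K(2) W(1) by (auto simp: subspace_neg)
      then show ?thesis unfolding A_def by blast
    qed
    show "0 \<in> A" using K0 W0 by (force simp: A_def)
    show "X \<subseteq> A" using X(2) W0 by (force simp: A_def)
    show "separated_by ((*\<^sub>R) s ` A) X"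
      unfolding separated_by_def
    proof (intro ballI impI notI)
      fix x y assume xy: "x \<in> X" "y \<in> X" "x \<noteq> y" "x - y \<in> (*\<^sub>R) s ` A"
      then obtain k w where "k \<in> K" "w \<in> W" "x - y = s *\<^sub>R k + s *\<^sub>R w"
        by (auto simp: A_def scaleR_right_distrib)
      then show False using sep[of x y k "s *\<^sub>R w"] xy W(1) by (auto simp: subspace_scale)
    qed
    fix r :: real and Y
    assume "0 < r" "r \<le> 1" "finite Y" "Y \<subseteq> A" "separated_by ((*\<^sub>R) r ` A) Y"
    then show "real (card Y) \<le> ((2 * M / \<eta>' + 2) / r) ^ card I"
      using crude_packing_bound[of I A f M \<eta>' r Y] finB fA M0 \<eta>' small by (auto simp: I_def)
  qed (use s X in auto)
qed

lemma packing_bound_ball: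
  assumes V: "subspace V" "V \<subseteq> euclid n" and z: "z \<in> V" and \<epsilon>: "0 < \<epsilon>" "\<epsilon> \<le> \<rho>"
    and X: "finite X" "X \<subseteq> V \<inter> cball z \<rho>" "pairwise (\<lambda>x y. \<epsilon> < dist x y) X"
  shows "real (card X) \<le> (4 * \<rho> / \<epsilon>) ^ dim V"
proof -
  let ?X = "(\<lambda>x. x - z) ` X"
  have "real (card ?X) \<le> (4 / (\<epsilon> / \<rho>)) ^ (dim V - dim ({0} :: fseq set))"
  proof (rule packing_bound_mod_subspace[OF V, of "{0}" "V \<inter> cball 0 \<rho>" \<rho> \<rho>])
    show "convex (V \<inter> cball 0 \<rho>)" by (intro convex_Int subspace_imp_convex V convex_cball)
    show "?X \<subseteq> V \<inter> cball 0 \<rho>"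
      using X(2) z V(1) by (auto simp: subspace_diff dist_norm norm_minus_commute)
    fix x y k w
    assume h: "x \<in> ?X" "y \<in> ?X" "k \<in> V \<inter> cball 0 \<rho>" "w \<in> {0}" "x - y = (\<epsilon> / \<rho>) *\<^sub>R k + w"
    have "norm (x - y) = \<epsilon> / \<rho> * norm k" using h \<epsilon> by simp
    also have "\<dots> \<le> \<epsilon> / \<rho> * \<rho>" using h \<epsilon> by (intro mult_left_mono) auto
    finally have "norm (x - y) \<le> \<epsilon>" using \<epsilon> by simp
    moreover obtain a b where "x = a - z" "y = b - z" "a \<in> X" "b \<in> X" using h by auto
    ultimately show "x = y" using pairwiseD[OF X(3), of a b] by (force simp: dist_norm)
  qed (use V X \<epsilon> in \<open>auto simp: subspace_neg subspace_0\<close>)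
  moreover have "dim ({0} :: fseq set) = 0" using dim_eq_card[of "{}" "{0} :: fseq set"]
    by (simp add: independent_empty)
  ultimately show ?thesis using \<epsilon> by (simp add: card_image)
qed

text \<open>
  Covering numbers of the ball are submultiplicative in the radius, so again only the exponent
  of a crude bound matters: a cover by balls of radius \<open>\<epsilon>\<close> yields a cover by at most
  \<open>(card X)\<^sup>j\<close> balls of radius \<open>\<epsilon>\<^sup>j\<close>, and a cubic grid gives a crude lower bound for the latter.
\<close>

lemma covering_bound_ball:
  assumes \<epsilon>: "0 < \<epsilon>" "\<epsilon> \<le> 1" and X: "finite X"
    and cover: "\<And>u. u \<in> euclid n \<inter> cball 0 1 \<Longrightarrow> \<exists>x\<in>X. dist x u \<le> \<epsilon>" and sub: "X \<subseteq> euclid n"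
  shows "(1 / \<epsilon>) ^ n \<le> real (card X)"
proof (cases "n = 0")
  case True
  have "0 \<in> euclid n \<inter> cball 0 1" using subspace_euclid by (simp add: subspace_0)
  then have "X \<noteq> {}" using cover by blast
  then show ?thesis using True X by (simp add: Suc_leI card_gt_0_iff)
next
  case False
  then have n: "0 < n" by simp
  have crude: "(1 / (3 * real n * r)) ^ n \<le> real (card Y)"
    if r: "0 < r" and Y: "finite Y" "\<And>u. u \<in> euclid n \<inter> cball 0 1 \<Longrightarrow> \<exists>x\<in>Y. dist x u \<le> r" for r Y
  proof -
    \<comment> \<open>A grid of mesh \<open>3 r\<close>: a ball of radius \<open>r\<close> contains at most one of its points.\<close>
    define q where "q = nat \<lfloor>1 / (3 * real n * r)\<rfloor>"
    define G where "G = (\<Pi>\<^sub>E i\<in>{..<n}. {..q})"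
    define p where "p g = (\<Sum>i<n. (3 * r * real (g i)) *\<^sub>R unit_vec i)" for g :: "nat \<Rightarrow> nat"
    have coord_p: "coord (p g) i = 3 * r * real (g i)" if "i < n" for g i
      using that by (simp add: p_def coord_unit_vec_combination)
    have q: "real q * (3 * real n * r) \<le> 1"
    proof -
      have "real q \<le> 1 / (3 * real n * r)" using r by (simp add: q_def)
      then show ?thesis using r n by (simp add: field_simps)
    qed
    have "p g \<in> euclid n \<inter> cball 0 1" if "g \<in> G" for g
    proof -
      have "norm (p g) \<le> (\<Sum>i<n. 3 * r * real q)"
        unfolding p_def
      proof (rule order.trans[OF norm_sum sum_mono])
        fix i assume "i \<in> {..<n}"
        then have "g i \<le> q" using that by (auto simp: G_def PiE_iff)
        then show "norm ((3 * r * real (g i)) *\<^sub>R unit_vec i) \<le> 3 * r * real q"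
          using r by (simp add: norm_unit_vec)
      qed
      then have "norm (p g) \<le> 1" using q by (simp add: algebra_simps)
      moreover have "p g \<in> euclid n" unfolding p_def
        by (intro subspace_sum subspace_euclid subspace_scale unit_vec_in_euclid) auto
      ultimately show ?thesis by simp
    qed
    then have "\<forall>g\<in>G. \<exists>x\<in>Y. dist x (p g) \<le> r" using Y(2) by blast
    then obtain h where h: "\<And>g. g \<in> G \<Longrightarrow> h g \<in> Y" "\<And>g. g \<in> G \<Longrightarrow> dist (h g) (p g) \<le> r" by metis
    have "inj_on h G"
    proof (rule inj_onI)
      fix g g' assume g: "g \<in> G" "g' \<in> G" "h g = h g'"
      have "dist (p g) (p g') \<le> 2 * r"
        using dist_triangle3[of "p g" "p g'" "h g"] h(2)[OF g(1)] h(2)[OF g(2)] g(3) by simp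
      then have d: "norm (p g - p g') \<le> 2 * r" by (simp add: dist_norm)
      have "g i = g' i" if "i < n" for i
      proof -
        have "\<bar>coord (p g - p g') i\<bar> \<le> 2 * r" using abs_coord_le_norm d order.trans by blast
        then have "\<bar>3 * r * (real (g i) - real (g' i))\<bar> \<le> 2 * r"
          by (simp add: minus_fseq.rep_eq coord_p that right_diff_distrib)
        then have "r * (3 * \<bar>real (g i) - real (g' i)\<bar>) \<le> r * 2" using r by (simp add: abs_mult)
        then have "\<bar>real (g i) - real (g' i)\<bar> < 1" using r by simp
        then show ?thesis by linarith
      qed
      then show "g = g'" using g by (intro PiE_ext[of g "{..<n}" _ g']) (auto simp: G_def)
    qed
    then have "card G \<le> card Y" using h(1) Y(1) by (intro card_inj_on_le[of h]) auto
    moreover have "card G = Suc q ^ n" by (simp add: G_def card_PiE)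
    ultimately have "real (Suc q) ^ n \<le> real (card Y)" by (metis of_nat_le_iff of_nat_power)
    moreover have "1 / (3 * real n * r) \<le> real (Suc q)" unfolding q_def by linarith
    then have "(1 / (3 * real n * r)) ^ n \<le> real (Suc q) ^ n" using r by (intro power_mono) auto
    ultimately show ?thesis by simp
  qed
  have ex: "\<exists>Y. finite Y \<and> card Y \<le> card X ^ j \<and>
      (\<forall>u\<in>euclid n \<inter> cball 0 1. \<exists>y\<in>Y. dist y u \<le> \<epsilon> ^ j)" for j
  proof (induction j)
    case 0
    show ?case by (intro exI[of _ "{0}"]) auto
  next
    case (Suc j)
    then obtain Y where Y: "finite Y" "card Y \<le> card X ^ j"
      "\<And>u. u \<in> euclid n \<inter> cball 0 1 \<Longrightarrow> \<exists>y\<in>Y. dist y u \<le> \<epsilon> ^ j" by blast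
    let ?Y = "(\<lambda>(x, y). x + \<epsilon> *\<^sub>R y) ` (X \<times> Y)"
    have "card ?Y \<le> card (X \<times> Y)" using X Y by (intro card_image_le) auto
    also have "\<dots> \<le> card X ^ Suc j" using Y(2) by (simp add: card_cartesian_product)
    finally have "card ?Y \<le> card X ^ Suc j" .
    moreover have "\<exists>y\<in>?Y. dist y u \<le> \<epsilon> ^ Suc j" if u: "u \<in> euclid n \<inter> cball 0 1" for u
    proof -
      obtain x where x: "x \<in> X" "dist x u \<le> \<epsilon>" using cover[OF u] by blast
      define v where "v = (1 / \<epsilon>) *\<^sub>R (u - x)"
      have "norm v \<le> 1" using x(2) \<epsilon> by (simp add: v_def dist_norm norm_minus_commute)
      moreover have "v \<in> euclid n"
        using u x(1) sub unfolding v_def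
        by (intro subspace_scale subspace_diff subspace_euclid) auto
      ultimately obtain y where y: "y \<in> Y" "dist y v \<le> \<epsilon> ^ j" using Y(3)[of v] by auto
      have "dist (x + \<epsilon> *\<^sub>R y) u = norm (\<epsilon> *\<^sub>R (y - v))"
        using \<epsilon> by (simp add: dist_norm v_def algebra_simps)
      also have "\<dots> \<le> \<epsilon> ^ Suc j" using y(2) \<epsilon> by (simp add: dist_norm)
      finally show ?thesis using x(1) y(1) by force
    qed
    ultimately show ?case using X Y(1) by (intro exI[of _ ?Y]) blast
  qed
  show ?thesis
  proof (rule le_if_powers_le_mult_powers)
    fix j :: nat
    obtain Y where Y: "finite Y" "card Y \<le> card X ^ j"
      "\<And>u. u \<in> euclid n \<inter> cball 0 1 \<Longrightarrow> \<exists>y\<in>Y. dist y u \<le> \<epsilon> ^ j" using ex[of j] by blast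
    have "(1 / (3 * real n * \<epsilon> ^ j)) ^ n \<le> real (card Y)" using \<epsilon> by (intro crude Y) auto
    also have "\<dots> \<le> real (card X) ^ j" using Y(2) by (metis of_nat_le_iff of_nat_power)
    finally have "(1 / (3 * real n * \<epsilon> ^ j)) ^ n * (3 * real n) ^ n
        \<le> real (card X) ^ j * (3 * real n) ^ n" by (intro mult_right_mono) auto
    moreover have "(1 / (3 * real n * \<epsilon> ^ j)) ^ n * (3 * real n) ^ n = ((1 / \<epsilon>) ^ n) ^ j"
      using n \<epsilon> by (simp add: power_divide power_mult_distrib power_mult[symmetric] mult.commute)
    ultimately show "((1 / \<epsilon>) ^ n) ^ j \<le> (3 * real n) ^ n * real (card X) ^ j"
      by (simp add: mult.commute)
  next
    have "0 \<in> euclid n \<inter> cball 0 1" using subspace_euclid by (simp add: subspace_0)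
    then have "X \<noteq> {}" using cover by blast
    then show "0 < real (card X)" using X by (simp add: card_gt_0_iff)
  qed (use \<epsilon> in auto)
qed

section \<open>Events on the Grassmannian\<close>

lemma near_point_if_infdist_less:
  assumes "A \<noteq> {}" "infdist x A < e"
  shows "\<exists>z\<in>A. dist x z < e"
  using assms by (subst (asm) infdist_notempty) (auto simp: cINF_less_iff)

lemma gap_commute: "gap E F = gap F E"
  by (simp add: gap_def max.commute)

lemma near_point_if_gap_less:
  assumes E: "subspace E" and F: "subspace F" and gap: "gap E F < \<delta>" and x: "x \<in> E"
  shows "\<exists>z\<in>F. norm (x - z) \<le> \<delta> * norm x"
proof (cases "x = 0")
  case True
  then show ?thesis using F by (intro bexI[of _ 0]) (auto simp: subspace_0)
next
  case False
  define u where "u = (1 / norm x) *\<^sub>R x"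
  have u: "u \<in> E \<inter> cball 0 1" using False x E by (simp add: u_def subspace_scale)
  have bdd: "bdd_above ((\<lambda>x. infdist x F) ` (E \<inter> cball 0 1))"
  proof (rule bdd_aboveI2)
    fix y assume "y \<in> E \<inter> cball 0 1"
    then show "infdist y F \<le> 1"
      using infdist_le[of 0 F y] subspace_0[OF F] by simp
  qed
  have "infdist u F \<le> (SUP x\<in>E \<inter> cball 0 1. infdist x F)" by (rule cSUP_upper[OF u bdd])
  also have "\<dots> < \<delta>" using gap by (simp add: gap_def)
  finally obtain z where z: "z \<in> F" "dist u z < \<delta>"
    using near_point_if_infdist_less[of F u \<delta>] subspace_0[OF F] by blast
  have "x - norm x *\<^sub>R z = norm x *\<^sub>R (u - z)" using False by (simp add: u_def algebra_simps)
  then have "norm (x - norm x *\<^sub>R z) = norm x * dist u z" by (simp add: dist_norm)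
  also have "\<dots> \<le> \<delta> * norm x" using mult_left_mono[of "dist u z" \<delta> "norm x"] z(2)
    by (simp add: mult.commute)
  finally show ?thesis using z(1) F by (intro bexI[of _ "norm x *\<^sub>R z"]) (auto simp: subspace_scale)
qed

lemma sets_grassmannian_borel:
  "sets (grassmannian_borel n m) = sigma_sets (grassmannian n m)
    {U. U \<subseteq> grassmannian n m \<and>
        (\<forall>E\<in>U. \<exists>\<epsilon>>0. \<forall>F\<in>grassmannian n m. gap E F < \<epsilon> \<longrightarrow> F \<in> U)}"
  unfolding grassmannian_borel_def by (rule sets_measure_of) auto

lemma space_grassmannian_borel: "space (grassmannian_borel n m) = grassmannian n m"
  unfolding grassmannian_borel_def by (rule space_measure_of) auto

lemma closed_in_grassmannian_borel:
  assumes "\<And>E. \<lbrakk>E \<in> grassmannian n m; \<not> P E\<rbrakk>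
    \<Longrightarrow> \<exists>\<epsilon>>0. \<forall>F\<in>grassmannian n m. gap E F < \<epsilon> \<longrightarrow> \<not> P F"
  shows "{E \<in> grassmannian n m. P E} \<in> sets (grassmannian_borel n m)"
proof -
  have "{E \<in> grassmannian n m. \<not> P E} \<in> sets (grassmannian_borel n m)"
    unfolding sets_grassmannian_borel using assms by (intro sigma_sets.Basic) simp
  from sets.compl_sets[OF this]
  have "grassmannian n m - {E \<in> grassmannian n m. \<not> P E} \<in> sets (grassmannian_borel n m)"
    by (simp only: space_grassmannian_borel)
  moreover have "grassmannian n m - {E \<in> grassmannian n m. \<not> P E} = {E \<in> grassmannian n m. P E}"
    by blast
  ultimately show ?thesis by simp
qed

lemma infdist_le_event_measurable:
  "{F \<in> grassmannian n m. infdist u F \<le> \<epsilon>} \<in> sets (grassmannian_borel n m)"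
proof (rule closed_in_grassmannian_borel)
  fix E assume E: "E \<in> grassmannian n m" "\<not> infdist u E \<le> \<epsilon>"
  define \<kappa> where "\<kappa> = (infdist u E - \<epsilon>) / 2"
  define r where "r = norm u + \<bar>\<epsilon>\<bar> + \<kappa> + 1"
  have \<kappa>: "0 < \<kappa>" using E by (simp add: \<kappa>_def)
  then have r: "1 \<le> r" by (simp add: r_def)
  show "\<exists>\<delta>>0. \<forall>F\<in>grassmannian n m. gap E F < \<delta> \<longrightarrow> \<not> infdist u F \<le> \<epsilon>"
  proof (intro exI[of _ "\<kappa> / r"] conjI ballI impI notI)
    show "0 < \<kappa> / r" using \<kappa> r by simp
    fix F assume F: "F \<in> grassmannian n m" "gap E F < \<kappa> / r" "infdist u F \<le> \<epsilon>"
    have sub: "subspace E" "subspace F" using E F by (auto simp: grassmannian_def)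
    obtain z where z: "z \<in> F" "dist u z < \<epsilon> + \<kappa>"
      using near_point_if_infdist_less[of F u "\<epsilon> + \<kappa>"] F(3) \<kappa> subspace_0[OF sub(2)] by force
    have "norm z \<le> norm u + dist u z"
      using norm_triangle_ineq4[of u "u - z"] by (simp add: dist_norm)
    then have zr: "norm z \<le> r" using z(2) by (simp add: r_def)
    obtain y where y: "y \<in> E" "norm (z - y) \<le> \<kappa> / r * norm z"
      using near_point_if_gap_less[OF sub(2,1) _ z(1)] F(2) gap_commute by metis
    have "\<kappa> / r * norm z \<le> \<kappa> / r * r" using zr \<kappa> r by (intro mult_left_mono) auto
    then have "dist z y \<le> \<kappa>" using y(2) r by (simp add: dist_norm)
    then have "dist u y < \<epsilon> + 2 * \<kappa>" using z(2) dist_triangle[of u y z] by linarith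
    moreover have "\<epsilon> + 2 * \<kappa> = infdist u E" by (simp add: \<kappa>_def field_simps)
    ultimately show False using infdist_le[OF y(1), of u] by linarith
  qed
qed

text \<open>
  Shrinking a point of \<open>K\<close> towards the interior point \<open>0\<close> leaves a ball around it inside \<open>K\<close>. A
  chord longer than \<open>D\<close> can therefore be moved into the sections by all nearby subspaces, so that
  the event is closed.
\<close>

lemma section_diameter_event_measurable:
  assumes conv: "convex K" and bdd: "bounded K" and \<eta>: "0 < \<eta>" "euclid n \<inter> cball 0 \<eta> \<subseteq> K"
    and sub: "K \<subseteq> euclid n" and "0 \<le> D"
  shows "{F \<in> grassmannian n m. diameter (K \<inter> F) \<le> D} \<in> sets (grassmannian_borel n m)"
proof (rule closed_in_grassmannian_borel)
  fix E assume E: "E \<in> grassmannian n m" "\<not> diameter (K \<inter> E) \<le> D"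
  have "\<exists>x\<in>K \<inter> E. \<exists>y\<in>K \<inter> E. D < norm (x - y)"
    using E(2) diameter_le[of "K \<inter> E" D] \<open>0 \<le> D\<close> by force
  then obtain x y where xy: "x \<in> K" "x \<in> E" "y \<in> K" "y \<in> E" "D < norm (x - y)" by blast
  define l where "l = norm (x - y)"
  have l: "0 < l" "D < l" using xy \<open>0 \<le> D\<close> by (auto simp: l_def)
  \<comment> \<open>Shrinking by \<open>1 - \<tau>\<close> brings the chord to the length \<open>(l + D) / 2\<close>; moving its ends by \<open>\<kappa>\<close> keeps
    them in \<open>K\<close> and the length above \<open>D\<close>.\<close>
  define \<tau> where "\<tau> = (l - D) / (2 * l)"
  have \<tau>: "0 < \<tau>" "\<tau> < 1" using l \<open>0 \<le> D\<close> by (auto simp: \<tau>_def field_simps)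
  have \<tau>l: "(1 - \<tau>) * l = (l + D) / 2" using l by (simp add: \<tau>_def field_simps)
  define \<kappa> where "\<kappa> = min (\<tau> * \<eta>) ((l - D) / 8)"
  have \<kappa>: "0 < \<kappa>" using \<tau> \<eta> l by (simp add: \<kappa>_def)
  define r where "r = 1 + norm x + norm y"
  have r: "1 \<le> r" by (simp add: r_def)
  show "\<exists>\<delta>>0. \<forall>F\<in>grassmannian n m. gap E F < \<delta> \<longrightarrow> \<not> diameter (K \<inter> F) \<le> D"
  proof (intro exI[of _ "\<kappa> / r"] conjI ballI impI notI)
    show "0 < \<kappa> / r" using \<kappa> r by simp
    fix F assume F: "F \<in> grassmannian n m" "gap E F < \<kappa> / r" "diameter (K \<inter> F) \<le> D"
    have subs: "subspace E" "subspace F" "F \<subseteq> euclid n" using E F by (auto simp: grassmannian_def)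
    have move: "\<exists>z\<in>K \<inter> F. norm ((1 - \<tau>) *\<^sub>R p - z) \<le> \<kappa>"
      if p: "p \<in> K" "p \<in> E" "norm p \<le> r" for p
    proof -
      let ?p = "(1 - \<tau>) *\<^sub>R p"
      obtain z where z: "z \<in> F" "norm (?p - z) \<le> \<kappa> / r * norm ?p"
        using near_point_if_gap_less[OF subs(1,2) F(2), of ?p] p subs(1)
        by (auto simp: subspace_scale)
      have "norm ?p \<le> 1 * norm p" using \<tau> unfolding norm_scaleR by (intro mult_right_mono) auto
      then have "\<kappa> / r * norm ?p \<le> \<kappa> / r * r" using \<kappa> r p by (intro mult_left_mono) auto
      then have near: "norm (?p - z) \<le> \<kappa>" using z(2) r by simp
      define b where "b = (1 / \<tau>) *\<^sub>R (z - ?p)"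
      have "norm (z - ?p) \<le> \<tau> * \<eta>" using near by (simp add: \<kappa>_def norm_minus_commute)
      moreover have "norm b = norm (z - ?p) / \<tau>" unfolding b_def norm_scaleR using \<tau> by simp
      ultimately have "norm b \<le> \<eta>" using \<tau> by (simp add: divide_le_eq mult.commute)
      moreover have "b \<in> euclid n"
        using z(1) subs(3) p(1) sub unfolding b_def
        by (intro subspace_scale subspace_diff subspace_euclid) auto
      ultimately have "b \<in> K" using \<eta> by auto
      moreover have "z = (1 - \<tau>) *\<^sub>R p + \<tau> *\<^sub>R b" using \<tau> by (simp add: b_def)
      ultimately have "z \<in> K" using convexD[OF conv p(1), of b "1 - \<tau>" \<tau>] \<tau> by simp
      then show ?thesis using z(1) near by blast
    qed
    obtain x' where x': "x' \<in> K \<inter> F" "norm ((1 - \<tau>) *\<^sub>R x - x') \<le> \<kappa>"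
      using move[of x] xy by (auto simp: r_def)
    obtain y' where y': "y' \<in> K \<inter> F" "norm ((1 - \<tau>) *\<^sub>R y - y') \<le> \<kappa>"
      using move[of y] xy by (auto simp: r_def)
    have "norm ((1 - \<tau>) *\<^sub>R x - (1 - \<tau>) *\<^sub>R y) = (1 - \<tau>) * l"
      using \<tau> by (simp add: l_def flip: scaleR_diff_right)
    moreover have "norm ((1 - \<tau>) *\<^sub>R x - (1 - \<tau>) *\<^sub>R y)
        \<le> norm ((1 - \<tau>) *\<^sub>R x - x') + norm (x' - y') + norm ((1 - \<tau>) *\<^sub>R y - y')"
      using dist_triangle[of "(1 - \<tau>) *\<^sub>R x" "(1 - \<tau>) *\<^sub>R y" x']
        dist_triangle[of x' "(1 - \<tau>) *\<^sub>R y" y']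
      by (simp add: dist_norm norm_minus_commute)
    ultimately have "(l + D) / 2 \<le> 2 * \<kappa> + norm (x' - y')" using x'(2) y'(2) \<tau>l by linarith
    moreover have "\<kappa> \<le> (l - D) / 8" by (simp only: \<kappa>_def min.cobounded2)
    ultimately have "D < dist x' y'" using l by (simp add: dist_norm field_simps)
    also have "\<dots> \<le> diameter (K \<inter> F)"
      using x'(1) y'(1) bdd by (intro diameter_bounded_bound) (auto intro: bounded_subset)
    finally show False using F(3) by simp
  qed
qed

section \<open>Rotations\<close>

text \<open>The witness is the reflection in the hyperplane orthogonal to \<open>u - v\<close>.\<close>

lemma rotation_exchanging_vectors:
  assumes u: "u \<in> euclid n" and v: "v \<in> euclid n" and eq: "norm u = norm v"
  obtains g where "g \<in> rotations n" "g u = v" "\<And>x. g (g x) = x"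
proof (cases "u = v")
  case True
  have "id \<in> rotations n" by (simp add: rotations_def orthogonal_transformation_def linear_iff)
  then show thesis using that[of id] True by simp
next
  case False
  define w where "w = u - v"
  define c where "c x = 2 * (x \<bullet> w) / (w \<bullet> w)" for x
  define g where "g x = x - c x *\<^sub>R w" for x
  have w: "w \<noteq> 0" "w \<bullet> w \<noteq> 0" "w \<in> euclid n"
    using False u v subspace_euclid by (auto simp: w_def subspace_diff)
  have cw: "c (x - a *\<^sub>R w) = c x - 2 * a" for x a
    using w by (simp add: c_def inner_diff_left field_simps)
  have c: "c (x + y) = c x + c y" "c (a *\<^sub>R x) = a * c x" for x y a
    by (simp_all add: c_def inner_add_left add_divide_distrib distrib_left)
  have lin: "linear g"
    by (rule linearI) (simp_all only: g_def c scaleR_add_left scaleR_right_diff_distrib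
        scaleR_scaleR add_diff_add)
  have "g x \<bullet> g y = x \<bullet> y" for x y
  proof -
    have cx: "c x * (w \<bullet> w) = 2 * (x \<bullet> w)" for x using w(2) by (simp add: c_def)
    have "g x \<bullet> g y = x \<bullet> y - c x * (w \<bullet> y) - c y * (x \<bullet> w - c x * (w \<bullet> w))"
      by (simp only: g_def inner_diff_left inner_diff_right inner_scaleR_left inner_scaleR_right)
    also have "\<dots> = x \<bullet> y - c x * (y \<bullet> w) + c y * (x \<bullet> w)"
      unfolding cx inner_commute[of w y] by (simp add: right_diff_distrib)
    also have "c y * (x \<bullet> w) = c x * (y \<bullet> w)" by (simp add: c_def)
    finally show ?thesis by simp
  qed
  then have orth: "orthogonal_transformation g"
    using lin by (simp add: orthogonal_transformation_def)
  have invol: "g (g x) = x" for x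
  proof -
    have "c (g x) = - c x" unfolding g_def cw by simp
    then show ?thesis by (simp add: g_def[of "g x"]) (simp add: g_def)
  qed
  have into: "g x \<in> euclid n" if "x \<in> euclid n" for x
    using that w subspace_euclid by (simp add: g_def subspace_diff subspace_scale)
  have "x \<in> g ` euclid n" if "x \<in> euclid n" for x
    using image_eqI[of x g "g x", OF invol[symmetric] into[OF that]] .
  then have "g ` euclid n = euclid n" using into by blast
  then have "g \<in> rotations n" using orth by (simp add: rotations_def)
  moreover have "g u = v"
  proof -
    have "u \<bullet> u = v \<bullet> v" using eq by (simp add: norm_eq)
    then have "w \<bullet> w = 2 * (u \<bullet> w)"
      by (simp add: w_def inner_diff_left inner_diff_right inner_commute)
    then have "c u = 1" using w by (simp add: c_def)
    then show ?thesis by (simp add: g_def w_def)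
  qed
  ultimately show thesis using that invol by blast
qed

lemma rotation_image_in_grassmannian:
  assumes "g \<in> rotations n" "E \<in> grassmannian n m"
  shows "g ` E \<in> grassmannian n m"
proof -
  have g: "orthogonal_transformation g" "g ` euclid n = euclid n" "linear g"
    using assms by (auto simp: rotations_def orthogonal_transformation_linear)
  have "inj g"
    using g(1) by (rule orthogonal_transformation_inj)
  obtain B where B: "B \<subseteq> E" "independent B" "E \<subseteq> span B" "card B = dim E"
    using basis_exists by blast
  have "subspace E" using assms(2) by (simp add: grassmannian_def)
  then have "span B = span E" using B by (intro span_eq[THEN iffD2] conjI) (auto intro: span_base)
  then have "span (g ` B) = span (g ` E)" by (simp add: linear_span_image[OF g(3)])
  moreover have "independent (g ` B)"
    using linear_independent_injective_image[OF g(3) B(2)] \<open>inj g\<close> by (auto intro: inj_on_subset)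
  ultimately have "dim (g ` E) = card (g ` B)" by (rule dim_eq_card)
  also have "\<dots> = dim E" using B(4) card_image[OF inj_on_subset[OF \<open>inj g\<close>]] by auto
  finally have "dim (g ` E) = dim E" .
  then show ?thesis
    using assms g by (auto simp: grassmannian_def linear_subspace_image)
qed

lemma infdist_orthogonal_image:
  assumes "orthogonal_transformation g"
  shows "infdist (g x) (g ` A) = infdist x A"
proof -
  have "dist (g x) (g a) = dist x a" for a
    using assms orthogonal_transformation_norm[OF assms, of "x - a"]
    by (simp add: dist_norm linear_diff orthogonal_transformation_linear)
  then show ?thesis by (simp add: infdist_def image_image)
qed

lemma haar_infdist_event_rotation_invariant:
  assumes haar: "haar_grassmannian n m \<mu>"
    and uv: "u \<in> euclid n" "v \<in> euclid n" "norm u = norm v"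
  shows "measure \<mu> {F \<in> grassmannian n m. infdist u F \<le> \<epsilon>}
    = measure \<mu> {F \<in> grassmannian n m. infdist v F \<le> \<epsilon>}"
proof -
  obtain g where g: "g \<in> rotations n" "g u = v" "\<And>x. g (g x) = x"
    using rotation_exchanging_vectors[OF uv] by blast
  have orth: "orthogonal_transformation g" using g(1) by (simp add: rotations_def)
  let ?S = "\<lambda>u. {F \<in> grassmannian n m. infdist u F \<le> \<epsilon>}"
  have gv: "g v = u" using g by metis
  have gg: "g ` g ` F = F" for F using g(3) by (simp add: image_image)
  have into: "g ` F \<in> ?S (g x)" if "F \<in> ?S x" for F x
    using that rotation_image_in_grassmannian[OF g(1)] infdist_orthogonal_image[OF orth] by simp
  have img: "(`) g ` ?S u = ?S v"
  proof
    show "(`) g ` ?S u \<subseteq> ?S v" using into[of _ u] g(2) by blast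
    show "?S v \<subseteq> (`) g ` ?S u"
    proof
      fix F assume "F \<in> ?S v"
      then have "g ` F \<in> ?S u" using into[of F v] gv by simp
      then show "F \<in> (`) g ` ?S u" using gg[of F] by (metis image_eqI)
    qed
  qed
  have meas: "?S u \<in> sets \<mu>"
    using infdist_le_event_measurable haar by (simp add: haar_grassmannian_def)
  have "\<forall>g\<in>rotations n. \<forall>\<A>\<in>sets \<mu>. emeasure \<mu> ((`) g ` \<A>) = emeasure \<mu> \<A>"
    using haar unfolding haar_grassmannian_def by (elim conjE)
  from bspec[OF bspec[OF this g(1)] meas] show ?thesis by (simp only: img measure_def)
qed

section \<open>A random subspace is rarely near a point\<close>

lemma infdist_scaleR_le:
  fixes x :: "'a::real_normed_vector"
  assumes F: "subspace F" and t: "0 \<le> t" "t \<le> 1"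
  shows "infdist (t *\<^sub>R x) F \<le> infdist x F"
proof -
  have "infdist (t *\<^sub>R x) F \<le> dist x z" if "z \<in> F" for z
  proof -
    have "dist (t *\<^sub>R x) (t *\<^sub>R z) = t * dist x z"
      unfolding dist_norm scaleR_diff_right[symmetric] norm_scaleR using t by simp
    also have "\<dots> \<le> dist x z" using t by (simp add: mult_left_le_one_le)
    finally show ?thesis using infdist_le2[of "t *\<^sub>R z" F] that F by (simp add: subspace_scale)
  qed
  then show ?thesis
    using subspace_0[OF F] by (subst (2) infdist_notempty) (auto intro: cINF_greatest)
qed

text \<open>
  The \<open>\<epsilon>\<close>-neighbourhood of \<open>F\<close> in the ball is covered by the balls of radius \<open>3 \<epsilon>\<close> around an
  \<open>\<epsilon>\<close>-net of a ball of \<open>F\<close>, and each of these balls has room for few separated points.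
\<close>

lemma card_separated_points_near_subspace:
  assumes F: "subspace F" "F \<subseteq> euclid n" and \<epsilon>: "0 < \<epsilon>" "\<epsilon> \<le> 1"
    and X: "finite X" "X \<subseteq> euclid n \<inter> cball 0 1" "pairwise (\<lambda>x y. \<epsilon> < dist x y) X"
  shows "real (card {x \<in> X. infdist x F \<le> \<epsilon>}) \<le> 12 ^ n * (12 / \<epsilon>) ^ dim F"
proof -
  have bound: "real (card Z) \<le> (12 / \<epsilon>) ^ dim F"
    if "finite Z" "Z \<subseteq> F \<inter> cball 0 3" "pairwise (\<lambda>x y. \<epsilon> < dist x y) Z" for Z
    using packing_bound_ball[OF F subspace_0[OF F(1)] _ _ that] \<epsilon> by simp
  have "\<exists>Z. separated_net \<epsilon> (F \<inter> cball 0 3) Z"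
    by (rule separated_net_exists, rule bound) (use \<epsilon> in simp_all)
  then obtain Z where Z: "finite Z" "Z \<subseteq> F \<inter> cball 0 3" "pairwise (\<lambda>x y. \<epsilon> < dist x y) Z"
    "\<forall>y\<in>F \<inter> cball 0 3. \<exists>z\<in>Z. dist z y \<le> \<epsilon>"
    unfolding separated_net_def by (elim exE conjE)
  define Y where "Y z = {x \<in> X. dist z x \<le> 3 * \<epsilon>}" for z
  have "{x \<in> X. infdist x F \<le> \<epsilon>} \<subseteq> (\<Union>z\<in>Z. Y z)"
  proof clarify
    fix x assume x: "x \<in> X" "infdist x F \<le> \<epsilon>"
    obtain w where w: "w \<in> F" "dist x w < 2 * \<epsilon>"
      using near_point_if_infdist_less[of F x "2 * \<epsilon>"] x(2) \<epsilon> subspace_0[OF F(1)] by force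
    have "norm w \<le> norm x + dist x w"
      using norm_triangle_ineq4[of x "x - w"] by (simp add: dist_norm)
    then have "w \<in> F \<inter> cball 0 3" using w x(1) X(2) \<epsilon> by force
    then obtain z where z: "z \<in> Z" "dist z w \<le> \<epsilon>" using Z(4) by blast
    have "dist z x \<le> 3 * \<epsilon>" using z(2) w(2) dist_triangle2[of z x w] by linarith
    then show "x \<in> (\<Union>z\<in>Z. Y z)" using x(1) z(1) by (auto simp: Y_def)
  qed
  then have "card {x \<in> X. infdist x F \<le> \<epsilon>} \<le> card (\<Union>z\<in>Z. Y z)"
    using Z(1) X(1) by (intro card_mono) (auto simp: Y_def)
  also have "\<dots> \<le> (\<Sum>z\<in>Z. card (Y z))" by (rule card_UN_le[OF Z(1)])
  finally have "real (card {x \<in> X. infdist x F \<le> \<epsilon>}) \<le> (\<Sum>z\<in>Z. real (card (Y z)))"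
    by (metis of_nat_le_iff of_nat_sum)
  also have "\<dots> \<le> (\<Sum>z\<in>Z. 12 ^ n)"
  proof (rule sum_mono)
    fix z assume "z \<in> Z"
    then have "z \<in> euclid n" using Z(2) F(2) by blast
    moreover have "finite (Y z)" "Y z \<subseteq> euclid n \<inter> cball z (3 * \<epsilon>)" "pairwise (\<lambda>x y. \<epsilon> < dist x y) (Y z)"
      using X pairwise_subset[OF X(3), of "Y z"] by (auto simp: Y_def)
    ultimately show "real (card (Y z)) \<le> 12 ^ n"
      using packing_bound_ball[OF subspace_euclid order_refl, of z n \<epsilon> "3 * \<epsilon>" "Y z"] \<epsilon>
      by (simp add: dim_euclid)
  qed
  also have "\<dots> \<le> 12 ^ n * (12 / \<epsilon>) ^ dim F" using bound[OF Z(1-3)] by (simp add: mult.commute)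
  finally show ?thesis .
qed

text \<open>
  By rotation invariance the probability is the same for all unit vectors, and it only increases
  when a unit vector is replaced by a point of the ball on the same ray. It is therefore at most
  the average, over the points of an \<open>\<epsilon>\<close>-net of the ball, of the probabilities that the subspace
  is near the point. Any fixed subspace of dimension \<open>m\<close> is near at most \<open>C\<^sup>n \<epsilon>\<^sup>-\<^sup>m\<close> of the at least
  \<open>\<epsilon>\<^sup>-\<^sup>n\<close> points of the net.
\<close>

lemma haar_prob_near_unit_vector:
  assumes haar: "haar_grassmannian n m \<mu>" and m: "m \<le> n"
    and u: "u \<in> euclid n" "norm u = 1" and \<epsilon>: "0 < \<epsilon>" "\<epsilon> \<le> 1"
  shows "measure \<mu> {F \<in> grassmannian n m. infdist u F \<le> \<epsilon>} \<le> 144 ^ n * \<epsilon> ^ (n - m)"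
proof -
  interpret prob_space \<mu> using haar by (simp add: haar_grassmannian_def)
  have space: "space \<mu> = grassmannian n m" using haar by (simp add: haar_grassmannian_def)
  define S where "S x = {F \<in> grassmannian n m. infdist x F \<le> \<epsilon>}" for x
  have meas: "S x \<in> sets \<mu>" for x
    using infdist_le_event_measurable haar by (simp add: S_def haar_grassmannian_def)
  define p where "p = measure \<mu> (S u)"
  let ?B = "euclid n \<inter> cball 0 1"
  have bound: "real (card X) \<le> (4 / \<epsilon>) ^ n"
    if "finite X" "X \<subseteq> ?B" "pairwise (\<lambda>x y. \<epsilon> < dist x y) X" for X
    using packing_bound_ball[OF subspace_euclid order_refl subspace_0[OF subspace_euclid] _ _ that] \<epsilon>
    by (simp add: dim_euclid)
  have "\<exists>X. separated_net \<epsilon> ?B X"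
    by (rule separated_net_exists, rule bound) (use \<epsilon> in simp_all)
  then obtain X where X: "finite X" "X \<subseteq> ?B" "pairwise (\<lambda>x y. \<epsilon> < dist x y) X"
    "\<forall>y\<in>?B. \<exists>x\<in>X. dist x y \<le> \<epsilon>"
    unfolding separated_net_def by (elim exE conjE)
  have cardX: "(1 / \<epsilon>) ^ n \<le> real (card X)"
    using X(2) by (intro covering_bound_ball[OF \<epsilon> X(1)] bspec[OF X(4)]) auto
  have "p \<le> measure \<mu> (S x)" if x: "x \<in> ?B" for x
  proof -
    define v where "v = (if x = 0 then u else (1 / norm x) *\<^sub>R x)"
    have v: "v \<in> euclid n" "norm v = 1" "x = norm x *\<^sub>R v"
      using u x subspace_scale[OF subspace_euclid] by (auto simp: v_def)
    have "p = measure \<mu> (S v)"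
      unfolding p_def S_def using u v by (intro haar_infdist_event_rotation_invariant[OF haar]) auto
    also have "\<dots> \<le> measure \<mu> (S x)"
    proof (rule finite_measure_mono[OF _ meas])
      have "infdist x F \<le> infdist v F" if "subspace F" for F
        using infdist_scaleR_le[OF that, of "norm x" v] x v(3) by simp
      then show "S v \<subseteq> S x" by (force simp: S_def grassmannian_def)
    qed
    finally show ?thesis .
  qed
  then have "(\<Sum>x\<in>X. p) \<le> (\<Sum>x\<in>X. measure \<mu> (S x))" using X(2) by (intro sum_mono) blast
  also have "\<dots> = (\<integral>F. (\<Sum>x\<in>X. indicator (S x) F) \<partial>\<mu>)"
    using meas by (subst Bochner_Integration.integral_sum)
      (auto simp: sets.Int_space_eq2 emeasure_eq_measure)
  also have "\<dots> \<le> 12 ^ n * (12 / \<epsilon>) ^ m"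
  proof (rule integral_le_const)
    show "integrable \<mu> (\<lambda>F. \<Sum>x\<in>X. indicator (S x) F :: real)"
      using meas by (intro Bochner_Integration.integrable_sum) (auto simp: emeasure_eq_measure)
    show "AE F in \<mu>. (\<Sum>x\<in>X. indicator (S x) F) \<le> 12 ^ n * (12 / \<epsilon>) ^ m"
    proof (rule AE_I2)
      fix F assume "F \<in> space \<mu>"
      then have F: "F \<in> grassmannian n m" by (simp add: space)
      then have "(\<Sum>x\<in>X. indicator (S x) F) = real (card {x \<in> X. infdist x F \<le> \<epsilon>})"
        using X(1) by (simp add: S_def indicator_def sum.If_cases Int_def)
      also have "\<dots> \<le> 12 ^ n * (12 / \<epsilon>) ^ dim F"
        using F X(1-3) \<epsilon> by (intro card_separated_points_near_subspace) (auto simp: grassmannian_def)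
      finally show "(\<Sum>x\<in>X. indicator (S x) F) \<le> 12 ^ n * (12 / \<epsilon>) ^ m"
        using F by (simp add: grassmannian_def)
    qed
  qed
  finally have "p * real (card X) \<le> 12 ^ n * (12 / \<epsilon>) ^ m" by (simp add: mult.commute)
  moreover have "p * (1 / \<epsilon>) ^ n \<le> p * real (card X)"
    using cardX by (intro mult_left_mono) (auto simp: p_def)
  ultimately have "p * (1 / \<epsilon>) ^ n \<le> 12 ^ n * (12 / \<epsilon>) ^ m" by linarith
  then have "p * (1 / \<epsilon>) ^ n * \<epsilon> ^ n \<le> 12 ^ n * (12 / \<epsilon>) ^ m * \<epsilon> ^ n"
    using \<epsilon> by (intro mult_right_mono) auto
  moreover have "p * (1 / \<epsilon>) ^ n * \<epsilon> ^ n = p" using \<epsilon> by (simp add: power_divide)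
  moreover have "12 ^ n * (12 / \<epsilon>) ^ m * \<epsilon> ^ n = 12 ^ n * 12 ^ m * \<epsilon> ^ (n - m)"
    using \<epsilon> m by (simp add: power_divide power_diff)
  ultimately have "p \<le> 12 ^ n * 12 ^ m * \<epsilon> ^ (n - m)" by simp
  also have "\<dots> \<le> 12 ^ n * 12 ^ n * \<epsilon> ^ (n - m)"
    using \<epsilon> m by (intro mult_right_mono mult_left_mono power_increasing) auto
  also have "\<dots> = 144 ^ n * \<epsilon> ^ (n - m)" by (simp flip: power_mult_distrib)
  finally show ?thesis by (simp add: p_def S_def)
qed

section \<open>Sections of convex bodies\<close>

lemma symmetric_convex_body_contains_ball:
  assumes "symmetric_convex_body n K"
  obtains \<eta> where "0 < \<eta>" "euclid n \<inter> cball 0 \<eta> \<subseteq> K"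
proof -
  have K: "convex K" "K = uminus ` K" "top_of_set (euclid n) interior_of K \<noteq> {}"
    using assms by (auto simp: symmetric_convex_body_def)
  then obtain x T where T: "openin (top_of_set (euclid n)) T" "x \<in> T" "T \<subseteq> K"
    by (auto simp: interior_of_def)
  obtain e where e: "0 < e" "cball x e \<inter> euclid n \<subseteq> T"
    using T(1,2) unfolding openin_contains_cball by blast
  have x: "x \<in> euclid n" "- x \<in> K"
    using T K(2) openin_imp_subset by blast+
  show thesis
  proof (rule that[of "e / 2"])
    show "euclid n \<inter> cball 0 (e / 2) \<subseteq> K"
    proof
      fix y assume y: "y \<in> euclid n \<inter> cball 0 (e / 2)"
      have "x + 2 *\<^sub>R y \<in> cball x e \<inter> euclid n"
        using y x(1) subspace_euclid by (auto simp: dist_norm subspace_add subspace_scale)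
      then have "x + 2 *\<^sub>R y \<in> K" using e T by blast
      from convexD[OF K(1) this x(2), of "1/2" "1/2"] show "y \<in> K"
        by (simp add: scaleR_right_distrib)
    qed
  qed (use e in simp)
qed

text \<open>
  A small section of codimension \<open>j\<close> makes the part of \<open>K\<close> at scale \<open>R\<close> essentially
  \<open>j\<close>-dimensional: if two points of it differ, modulo \<open>E\<close>, by a small multiple of a third one,
  then their difference is that multiple plus a vector of a multiple of \<open>K \<inter> E\<close>, and both are short.
\<close>

lemma packing_bound_of_bounded_section:
  assumes K: "convex K" "K \<subseteq> euclid n" and sym: "\<And>x. x \<in> K \<Longrightarrow> - x \<in> K"
    and ball: "0 < \<eta>" "euclid n \<inter> cball 0 \<eta> \<subseteq> K"
    and E: "subspace E" "E \<subseteq> euclid n" and sec: "K \<inter> E \<subseteq> cball 0 1"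
    and R: "1 \<le> R"
    and X: "finite X" "\<And>x. x \<in> X \<Longrightarrow> R *\<^sub>R x \<in> K" "X \<subseteq> cball 0 1"
      "pairwise (\<lambda>x y. 4 / R < dist x y) X"
  shows "real (card X) \<le> (4 * R) ^ (n - dim E)"
proof -
  define K' where "K' = {x. R *\<^sub>R x \<in> K} \<inter> cball 0 1"
  have K0: "0 \<in> K" using ball subspace_0[OF subspace_euclid] by auto
  have euclidI: "x \<in> euclid n" if "R *\<^sub>R x \<in> euclid n" for x
    using subspace_scale[OF subspace_euclid that, of "1 / R"] R by simp
  have "real (card X) \<le> (4 / (1 / R)) ^ (dim (euclid n) - dim E)"
  proof (rule packing_bound_mod_subspace[OF subspace_euclid order_refl E, of K' 1 "min 1 (\<eta> / R)"])
    have "{x. R *\<^sub>R x \<in> K} = (*\<^sub>R) R -` K" by auto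
    then show "convex K'"
      unfolding K'_def using K(1) by (auto intro!: convex_Int convex_linear_vimage linear_scale_self)
    show "K' \<subseteq> euclid n" using K(2) euclidI by (auto simp: K'_def)
    show "euclid n \<inter> cball 0 (min 1 (\<eta> / R)) \<subseteq> K'"
    proof
      fix x assume x: "x \<in> euclid n \<inter> cball 0 (min 1 (\<eta> / R))"
      then have "norm (R *\<^sub>R x) \<le> \<eta>" using R by (simp add: field_simps)
      then have "R *\<^sub>R x \<in> K" using ball x subspace_scale[OF subspace_euclid] by auto
      then show "x \<in> K'" using x by (simp add: K'_def)
    qed
    fix x y k w
    assume h: "x \<in> X" "y \<in> X" "k \<in> K'" "w \<in> E" "x - y = (1 / R) *\<^sub>R k + w"
    have Kxyk: "R *\<^sub>R x \<in> K" "- (R *\<^sub>R y) \<in> K" "- (R *\<^sub>R k) \<in> K"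
      using h X(2) sym by (auto simp: K'_def)
    have "(1/3) *\<^sub>R (R *\<^sub>R x) + (1/3) *\<^sub>R (- (R *\<^sub>R y)) + (1 / (3 * R)) *\<^sub>R (- (R *\<^sub>R k)) \<in> K"
      using R by (intro convex_combination3_mem[OF K(1) K0] Kxyk) (auto simp: field_simps)
    also have "(1/3) *\<^sub>R (R *\<^sub>R x) + (1/3) *\<^sub>R (- (R *\<^sub>R y)) + (1 / (3 * R)) *\<^sub>R (- (R *\<^sub>R k))
        = (R / 3) *\<^sub>R (x - y - (1 / R) *\<^sub>R k)"
      using R by (simp add: algebra_simps)
    also have "\<dots> = (R / 3) *\<^sub>R w" using h(5) by simp
    finally have "(R / 3) *\<^sub>R w \<in> K \<inter> E" using h(4) E(1) by (simp add: subspace_scale)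
    then have "norm ((R / 3) *\<^sub>R w) \<le> 1" using sec by auto
    then have "norm w \<le> 3 / R" using R by (simp add: field_simps)
    moreover have "norm ((1 / R) *\<^sub>R k) \<le> 1 / R" using h(3) R by (simp add: K'_def field_simps)
    ultimately have "dist x y \<le> 4 / R"
      unfolding dist_norm h(5) using norm_triangle_ineq[of "(1 / R) *\<^sub>R k" w] by (simp add: field_simps)
    then show "x = y" using pairwiseD[OF X(4) h(1,2)] by force
  qed (use X R ball sym in \<open>auto simp: K'_def\<close>)
  then show ?thesis using R by (simp add: dim_euclid)
qed

text \<open>
  A subspace with a section longer than \<open>D\<close> contains a unit vector of \<open>(2 / D) K\<close>, and so comes
  near a point of an \<open>\<epsilon>\<close>-net of these vectors, where \<open>\<epsilon> = 8 / D\<close>. The union bound multiplies the two estimates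
  \<open>(C / \<epsilon>)\<^sup>n\<^sup>-\<^sup>d\<close> and \<open>C\<^sup>n \<epsilon>\<^sup>n\<^sup>-\<^sup>m\<close>, and the excess \<open>d - m\<close> of the dimensions survives.
\<close>

lemma random_section_diameter_tail:
  assumes body: "symmetric_convex_body n K"
    and E: "E \<in> grassmannian n d" and diam: "diameter (K \<inter> E) \<le> 1"
    and haar: "haar_grassmannian n m \<mu>" and dims: "m \<le> d" "d \<le> n" and D: "8 \<le> D"
  shows "measure \<mu> {F \<in> grassmannian n m. \<not> diameter (K \<inter> F) \<le> D} \<le> 2304 ^ n * (8 / D) ^ (d - m)"
proof -
  interpret prob_space \<mu> using haar by (simp add: haar_grassmannian_def)
  have K: "convex K" "K \<subseteq> euclid n" "compact K" and sym: "\<And>x. x \<in> K \<Longrightarrow> - x \<in> K"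
    using body by (auto simp: symmetric_convex_body_def)
  obtain \<eta> where \<eta>: "0 < \<eta>" "euclid n \<inter> cball 0 \<eta> \<subseteq> K"
    using symmetric_convex_body_contains_ball[OF body] .
  have K0: "0 \<in> K" using \<eta> subspace_0[OF subspace_euclid] by auto
  have E': "subspace E" "E \<subseteq> euclid n" "dim E = d" using E by (auto simp: grassmannian_def)
  have sec: "K \<inter> E \<subseteq> cball 0 1"
  proof
    fix x assume x: "x \<in> K \<inter> E"
    have "dist 0 x \<le> diameter (K \<inter> E)"
      using x K0 subspace_0[OF E'(1)] compact_imp_bounded[OF K(3)]
      by (intro diameter_bounded_bound) (auto intro: bounded_subset)
    then show "x \<in> cball 0 1" using diam by simp
  qed
  define R where "R = D / 2"
  define \<epsilon> where "\<epsilon> = 8 / D"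
  have R: "1 \<le> R" "4 / R = \<epsilon>" "4 * R = 16 / \<epsilon>" using D by (auto simp: R_def \<epsilon>_def field_simps)
  have \<epsilon>: "0 < \<epsilon>" "\<epsilon> \<le> 1" using D by (auto simp: \<epsilon>_def)
  define T where "T = {u \<in> euclid n. norm u = 1 \<and> R *\<^sub>R u \<in> K}"
  have bound: "real (card X) \<le> (16 / \<epsilon>) ^ (n - d)"
    if "finite X" "X \<subseteq> T" "pairwise (\<lambda>x y. \<epsilon> < dist x y) X" for X
    unfolding R(3)[symmetric] E'(3)[symmetric]
    by (rule packing_bound_of_bounded_section[OF K(1,2) sym \<eta> E'(1,2) sec R(1)])
      (use that R in \<open>auto simp: T_def\<close>)
  have "\<exists>X. separated_net \<epsilon> T X"
    by (rule separated_net_exists, rule bound) (use \<epsilon> in simp_all)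
  then obtain X where X: "finite X" "X \<subseteq> T" "pairwise (\<lambda>x y. \<epsilon> < dist x y) X"
    "\<forall>y\<in>T. \<exists>x\<in>X. dist x y \<le> \<epsilon>"
    unfolding separated_net_def by (elim exE conjE)
  define S where "S x = {F \<in> grassmannian n m. infdist x F \<le> \<epsilon>}" for x
  have meas: "S x \<in> sets \<mu>" for x
    using infdist_le_event_measurable haar by (simp add: S_def haar_grassmannian_def)
  have "{F \<in> grassmannian n m. \<not> diameter (K \<inter> F) \<le> D} \<subseteq> (\<Union>x\<in>X. S x)"
  proof clarify
    fix F assume F: "F \<in> grassmannian n m" and large: "\<not> diameter (K \<inter> F) \<le> D"
    have F': "subspace F" "F \<subseteq> euclid n" using F by (auto simp: grassmannian_def)
    obtain y where y: "y \<in> K" "y \<in> F" "R < norm y"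
    proof (rule ccontr)
      assume "\<not> thesis"
      then have small: "\<And>y. y \<in> K \<Longrightarrow> y \<in> F \<Longrightarrow> norm y \<le> R" using that by force
      have "diameter (K \<inter> F) \<le> D"
      proof (rule diameter_le)
        fix x y assume "x \<in> K \<inter> F" "y \<in> K \<inter> F"
        then have "norm x \<le> R" "norm y \<le> R" using small by auto
        then show "norm (x - y) \<le> D" using norm_triangle_ineq4[of x y] by (simp add: R_def)
      qed (use D in auto)
      then show False using large by simp
    qed
    define u where "u = (1 / norm y) *\<^sub>R y"
    have "y \<noteq> 0" using y R by auto
    have "R *\<^sub>R u = (R / norm y) *\<^sub>R y" by (simp add: u_def)
    also have "\<dots> \<in> K" using y R by (intro convex_scaleR_mem[OF K(1) K0]) (auto simp: divide_le_eq_1)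
    finally have "R *\<^sub>R u \<in> K" .
    moreover have "u \<in> F" using y F' by (simp add: u_def subspace_scale)
    ultimately have "u \<in> T" using F' \<open>y \<noteq> 0\<close> by (auto simp: T_def u_def)
    then obtain x where "x \<in> X" "dist x u \<le> \<epsilon>" using X(4) by blast
    then show "F \<in> (\<Union>x\<in>X. S x)"
      using infdist_le2[OF \<open>u \<in> F\<close>, of x \<epsilon>] F by (auto simp: S_def)
  qed
  then have "measure \<mu> {F \<in> grassmannian n m. \<not> diameter (K \<inter> F) \<le> D} \<le> measure \<mu> (\<Union>x\<in>X. S x)"
    using meas X(1) by (intro finite_measure_mono) auto
  also have "\<dots> \<le> (\<Sum>x\<in>X. measure \<mu> (S x))"
    using meas X(1) by (intro finite_measure_subadditive_finite) auto
  also have "\<dots> \<le> (\<Sum>x\<in>X. 144 ^ n * \<epsilon> ^ (n - m))"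
    unfolding S_def using X(2) dims \<epsilon>
    by (intro sum_mono haar_prob_near_unit_vector[OF haar]) (auto simp: T_def)
  also have "\<dots> = real (card X) * (144 ^ n * \<epsilon> ^ (n - m))" by simp
  also have "\<dots> \<le> (16 / \<epsilon>) ^ (n - d) * (144 ^ n * \<epsilon> ^ (n - m))"
    using bound[OF X(1-3)] \<epsilon> by (intro mult_right_mono) auto
  also have "n - m = (n - d) + (d - m)" using dims by simp
  then have "(16 / \<epsilon>) ^ (n - d) * (144 ^ n * \<epsilon> ^ (n - m)) = 16 ^ (n - d) * 144 ^ n * \<epsilon> ^ (d - m)"
    using \<epsilon> by (simp add: power_add power_divide)
  also have "\<dots> \<le> 16 ^ n * 144 ^ n * \<epsilon> ^ (d - m)"
    using \<epsilon> by (intro mult_right_mono power_increasing) auto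
  also have "\<dots> = 2304 ^ n * \<epsilon> ^ (d - m)" by (simp flip: power_mult_distrib)
  finally show ?thesis by (simp add: \<epsilon>_def)
qed

text \<open>
  With \<open>\<epsilon> = 8 / C\<^sup>n\<^sup>/\<^sup>k\<close>, an excess of \<open>k / 2\<close> dimensions turns the bound into
  at most \<open>(2304 * 8 / sqrt C)\<^sup>n\<close>; the choice of \<open>C\<close> makes the base less than \<open>1 / 2 \<le> exp (- 1 / 2)\<close>.
\<close>

lemma random_section_diameter_prob:
  assumes body: "symmetric_convex_body n K"
    and E: "E \<in> grassmannian n d" and diam: "diameter (K \<inter> E) \<le> 1"
    and haar: "haar_grassmannian n m \<mu>" and dims: "m \<le> d" "d \<le> n" "k \<le> 2 * (d - m)"
    and k: "1 \<le> k" "k \<le> n"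
  shows "\<P>(F in \<mu>. diameter (K \<inter> F) \<le> (60000 ^ 2) powr (real n / real k))
    \<ge> 1 - exp (- (1 / 2) * real n)"
proof -
  interpret prob_space \<mu> using haar by (simp add: haar_grassmannian_def)
  have space: "space \<mu> = grassmannian n m" using haar by (simp add: haar_grassmannian_def)
  define D :: real where "D = (60000 ^ 2) powr (real n / real k)"
  have "(60000 ^ 2) powr 1 \<le> D" unfolding D_def using k by (intro powr_mono) auto
  then have D: "8 \<le> D" by simp
  have Dk: "D ^ k = (60000 ^ 2) ^ n"
  proof -
    have "D ^ k = D powr real k" using D by (simp add: powr_realpow)
    also have "\<dots> = (60000 ^ 2) powr real n" using k by (simp add: D_def powr_powr)
    finally show ?thesis by (simp add: powr_realpow)
  qed
  define p where "p = measure \<mu> {F \<in> grassmannian n m. \<not> diameter (K \<inter> F) \<le> D}"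
  have p: "p \<le> 2304 ^ n * (8 / D) ^ (d - m)"
    unfolding p_def by (rule random_section_diameter_tail[OF body E diam haar dims(1,2) D])
  have "((8 / D) ^ (d - m))\<^sup>2 = (8 / D) ^ (2 * (d - m))" by (simp add: mult.commute flip: power_mult)
  also have "\<dots> \<le> (8 / D) ^ k" using D dims(3) by (intro power_decreasing) auto
  also have "\<dots> = 8 ^ k / (60000 ^ 2) ^ n" by (simp add: power_divide Dk)
  also have "\<dots> \<le> 8 ^ n / (60000 ^ 2) ^ n" using k by (intro divide_right_mono power_increasing) auto
  also have "\<dots> \<le> (8 ^ n)\<^sup>2 / (60000 ^ 2) ^ n"
    by (intro divide_right_mono) (auto intro!: self_le_power)
  also have "\<dots> = ((8 / 60000) ^ n)\<^sup>2"
    by (simp only: power_divide power_mult[symmetric] mult.commute)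
  finally have "(8 / D) ^ (d - m) \<le> (8 / 60000) ^ n" by (rule power2_le_imp_le) simp
  then have "2304 ^ n * (8 / D) ^ (d - m) \<le> 2304 ^ n * (8 / 60000) ^ n"
    by (intro mult_left_mono) auto
  also have "\<dots> = (2304 * (8 / 60000)) ^ n" by (rule power_mult_distrib[symmetric])
  also have "\<dots> \<le> (1 / 2) ^ n" by (intro power_mono) auto
  also have "\<dots> \<le> exp (- (1 / 2)) ^ n"
  proof (rule power_mono)
    show "1 / 2 \<le> exp (- (1 / 2) :: real)" using exp_ge_add_one_self[of "- (1 / 2) :: real"] by simp
  qed simp
  also have "\<dots> = exp (- (1 / 2) * real n)" by (simp add: mult.commute flip: exp_of_nat_mult)
  finally have "p \<le> exp (- (1 / 2) * real n)" using p by linarith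
  moreover have "\<P>(F in \<mu>. diameter (K \<inter> F) \<le> D) = 1 - p"
  proof -
    obtain \<eta> where "0 < \<eta>" "euclid n \<inter> cball 0 \<eta> \<subseteq> K"
      using symmetric_convex_body_contains_ball[OF body] .
    then have "{F \<in> space \<mu>. diameter (K \<inter> F) \<le> D} \<in> events"
      using section_diameter_event_measurable[of K \<eta> n D m] body D haar
      by (auto simp: symmetric_convex_body_def compact_imp_bounded haar_grassmannian_def)
    then show ?thesis unfolding p_def space[symmetric] using prob_neg by simp
  qed
  ultimately show ?thesis by (simp add: D_def)
qed

theorem corollary1p2:
  shows "\<exists>c C :: real. 0 < c \<and> c < 1 \<and> 0 < C \<and>
    (\<forall>(n::nat) (k::nat) (K :: fseq set).
      1 \<le> k \<and> k \<le> n \<and> symmetric_convex_body n K \<longrightarrow>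
      ((\<exists>E\<in>grassmannian n k. diameter (K \<inter> E) \<le> 1) \<longrightarrow>
        (\<forall>\<mu>. haar_grassmannian n (nat \<lfloor>c * real k\<rfloor>) \<mu> \<longrightarrow>
          \<P>(E in \<mu>. diameter (K \<inter> E) \<le> C powr (real n / real k)) \<ge> 1 - exp (- c * real n)))
      \<and>
      ((\<exists>E\<in>grassmannian n (n - nat \<lfloor>c * real k\<rfloor>). diameter (K \<inter> E) \<le> 1) \<longrightarrow>
        (\<forall>\<mu>. haar_grassmannian n (n - k) \<mu> \<longrightarrow>
          \<P>(E in \<mu>. diameter (K \<inter> E) \<le> C powr (real n / real k)) \<ge> 1 - exp (- c * real n))))"
proof (rule exI[of _ "1 / 2"], rule exI[of _ "60000 ^ 2"], intro conjI allI impI)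
  fix n k :: nat and K :: "fseq set" and \<mu>
  assume "1 \<le> k \<and> k \<le> n \<and> symmetric_convex_body n K"
  then have k: "1 \<le> k" "k \<le> n" and body: "symmetric_convex_body n K" by auto
  assume "\<exists>E\<in>grassmannian n k. diameter (K \<inter> E) \<le> 1"
  then obtain E where E: "E \<in> grassmannian n k" "diameter (K \<inter> E) \<le> 1" by blast
  assume haar: "haar_grassmannian n (nat \<lfloor>1 / 2 * real k\<rfloor>) \<mu>"
  have "2 * nat \<lfloor>1 / 2 * real k\<rfloor> \<le> k" by linarith
  then show "\<P>(E in \<mu>. diameter (K \<inter> E) \<le> (60000 ^ 2) powr (real n / real k))
      \<ge> 1 - exp (- (1 / 2) * real n)"
    using k by (intro random_section_diameter_prob[OF body E haar]) linarith+
next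
  fix n k :: nat and K :: "fseq set" and \<mu>
  assume "1 \<le> k \<and> k \<le> n \<and> symmetric_convex_body n K"
  then have k: "1 \<le> k" "k \<le> n" and body: "symmetric_convex_body n K" by auto
  assume "\<exists>E\<in>grassmannian n (n - nat \<lfloor>1 / 2 * real k\<rfloor>). diameter (K \<inter> E) \<le> 1"
  then obtain E where E: "E \<in> grassmannian n (n - nat \<lfloor>1 / 2 * real k\<rfloor>)"
    "diameter (K \<inter> E) \<le> 1" by blast
  assume haar: "haar_grassmannian n (n - k) \<mu>"
  have "2 * nat \<lfloor>1 / 2 * real k\<rfloor> \<le> k" by linarith
  then show "\<P>(E in \<mu>. diameter (K \<inter> E) \<le> (60000 ^ 2) powr (real n / real k))
      \<ge> 1 - exp (- (1 / 2) * real n)"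
    using k by (intro random_section_diameter_prob[OF body E haar]) linarith+
qed simp_all

end
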